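(* Let $E$ be a Banach space, $p\in(1,2)$ and $\alpha\in(0,\frac1p-\frac12)$. If $C^\alpha([0,1];E)\hookrightarrow\gamma((0,1);E)$ (i.e. every $\alpha$-Hölder continuous $f:[0,1]\to E$ belongs to $\gamma((0,1);E)$ and the inclusion is continuous), then $E$ has type $p$.
   Context: $C^\alpha([0,1];E)$ is the space of $f:[0,1]\to E$ with $\|f\|_{C^\alpha}=\sup_t\|f(t)\|+\sup_{s<t}\|f(t)-f(s)\|/|t-s|^\alpha<\infty$. $\gamma((0,1);E)$ is the space of strongly measurable $f:(0,1)\to E$ with $\langle f,x^*\rangle\in L^2(0,1)$ for all $x^*\in E^*$ such that $I_f:L^2(0,1)\to E$, $I_fg=\int_0^1fg\,dt$, belongs to $\gamma(L^2(0,1),E)$, normed by $\|I_f\|_{\gamma(L^2(0,1),E)}$; here $\gamma(H,E)$ is the completion of finite rank operators $Rh=\sum_{n=1}^N[h,h_n]x_n$ ($h_n$ orthonormal) in the norm $(\mathbb E\|\sum\gamma_nRh_n\|^2)^{1/2}$, $(\gamma_n)$ i.i.d. standard Gaussians. $E$ has type $p$ if there is $C$ with $(\mathbb E\|\sum r_nx_n\|^2)^{1/2}\le C(\sum\|x_n\|^p)^{1/p}$ for all finite sequences in $E$, $(r_n)$ Rademacher. *)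

theory Defs
  imports "HOL-Probability.Probability"
begin

definition sup_part :: "(real \<Rightarrow> 'a::real_normed_vector) \<Rightarrow> real set" where
  "sup_part f = {norm (f t) | t. t \<in> {0..1}}"

definition hoelder_part :: "real \<Rightarrow> (real \<Rightarrow> 'a::real_normed_vector) \<Rightarrow> real set" where
  "hoelder_part \<alpha> f = {norm (f t - f s) / \<bar>t - s\<bar> powr \<alpha> | s t. 0 \<le> s \<and> s < t \<and> t \<le> 1}"

definition hoelder_space :: "real \<Rightarrow> (real \<Rightarrow> 'a::real_normed_vector) set" where
  "hoelder_space \<alpha> = {f. bdd_above (sup_part f) \<and> bdd_above (hoelder_part \<alpha> f)}"

definition hoelder_norm :: "real \<Rightarrow> (real \<Rightarrow> 'a::real_normed_vector) \<Rightarrow> real" where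
  "hoelder_norm \<alpha> f = Sup (sup_part f) + Sup (hoelder_part \<alpha> f)"

definition L2_01 :: "(real \<Rightarrow> real) \<Rightarrow> bool" where
  "L2_01 g \<longleftrightarrow> g \<in> borel_measurable (restrict_space lborel {0<..<1})
     \<and> set_integrable lborel {0<..<1} (\<lambda>t. (g t)\<^sup>2)"

definition l2ip :: "(real \<Rightarrow> real) \<Rightarrow> (real \<Rightarrow> real) \<Rightarrow> real" where
  "l2ip g h = (LINT t:{0<..<1}|lborel. g t * h t)"

definition l2norm :: "(real \<Rightarrow> real) \<Rightarrow> real" where
  "l2norm g = sqrt (l2ip g g)"

definition orthonormal_sys :: "nat \<Rightarrow> (nat \<Rightarrow> real \<Rightarrow> real) \<Rightarrow> bool" where
  "orthonormal_sys N h \<longleftrightarrow> (\<forall>n<N. L2_01 (h n))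
     \<and> (\<forall>m<N. \<forall>n<N. l2ip (h m) (h n) = (if m = n then 1 else 0))"

definition std_gaussian_vec :: "nat \<Rightarrow> (nat \<Rightarrow> real) measure" where
  "std_gaussian_vec N = PiM {..<N} (\<lambda>_. density lborel std_normal_density)"

definition gauss_sq :: "nat \<Rightarrow> (nat \<Rightarrow> 'a::real_normed_vector) \<Rightarrow> real" where
  "gauss_sq N x = (\<integral>\<omega>. (norm (\<Sum>n<N. \<omega> n *\<^sub>R x n))\<^sup>2 \<partial>std_gaussian_vec N)"

definition rademacher_sq :: "nat \<Rightarrow> (nat \<Rightarrow> 'a::real_normed_vector) \<Rightarrow> real" where
  "rademacher_sq N x =
     (\<Sum>\<epsilon>\<in>({..<N} \<rightarrow>\<^sub>E {-1, 1::real}). (norm (\<Sum>n<N. \<epsilon> n *\<^sub>R x n))\<^sup>2) / 2 ^ N"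

definition has_type :: "real \<Rightarrow> 'a::real_normed_vector itself \<Rightarrow> bool" where
  "has_type p _ \<longleftrightarrow> (\<exists>C. \<forall>N (x :: nat \<Rightarrow> 'a).
      sqrt (rademacher_sq N x) \<le> C * (\<Sum>n<N. norm (x n) powr p) powr (1 / p))"

text \<open>Operators L^2(0,1) -> E are represented as functions on real => real;
  only their values on L^2 functions matter.\<close>

definition finite_rank_op :: "((real \<Rightarrow> real) \<Rightarrow> 'a::real_normed_vector) \<Rightarrow> bool" where
  "finite_rank_op R \<longleftrightarrow> (\<exists>N h x. orthonormal_sys N h \<and>
      (\<forall>g. L2_01 g \<longrightarrow> R g = (\<Sum>n<N. l2ip g (h n) *\<^sub>R x n)))"

text \<open>gamma-norm, as a supremum over finite orthonormal systems; on finite rank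
  operators it coincides with (E||sum gamma_n R h_n||^2)^(1/2) for any orthonormal
  system h_n carrying R.\<close>
definition gnorm :: "((real \<Rightarrow> real) \<Rightarrow> 'a::real_normed_vector) \<Rightarrow> real" where
  "gnorm T = (SUP (N, e) \<in> {(N, e). orthonormal_sys N e}. sqrt (gauss_sq N (\<lambda>n. T (e n))))"

text \<open>Approximation of T by a gamma-Cauchy sequence of finite rank operators
  (the completion of the finite rank operators, realised inside the operators).\<close>
definition gamma_approx :: "(nat \<Rightarrow> (real \<Rightarrow> real) \<Rightarrow> 'a::real_normed_vector)
     \<Rightarrow> ((real \<Rightarrow> real) \<Rightarrow> 'a) \<Rightarrow> bool" where
  "gamma_approx R T \<longleftrightarrow> (\<forall>k. finite_rank_op (R k))
     \<and> (\<forall>\<epsilon>>0. \<exists>K. \<forall>k\<ge>K. \<forall>l\<ge>K. gnorm (\<lambda>g. R k g - R l g) < \<epsilon>)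
     \<and> (\<forall>g. L2_01 g \<longrightarrow> (\<lambda>k. R k g) \<longlonglongrightarrow> T g)"

definition gamma_op :: "((real \<Rightarrow> real) \<Rightarrow> 'a::real_normed_vector) \<Rightarrow> bool" where
  "gamma_op T \<longleftrightarrow> (\<exists>R. gamma_approx R T)"

definition gamma_op_norm :: "((real \<Rightarrow> real) \<Rightarrow> 'a::real_normed_vector) \<Rightarrow> real" where
  "gamma_op_norm T = lim (\<lambda>k. gnorm ((SOME R. gamma_approx R T) k))"

definition strongly_measurable_01 :: "(real \<Rightarrow> 'a::real_normed_vector) \<Rightarrow> bool" where
  "strongly_measurable_01 f \<longleftrightarrow> (\<exists>s :: nat \<Rightarrow> real \<Rightarrow> 'a.
      (\<forall>k. s k \<in> borel_measurable (restrict_space lborel {0<..<1}) \<and> finite (s k ` {0<..<1}))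
      \<and> (AE t in lborel. t \<in> {0<..<1} \<longrightarrow> (\<lambda>k. s k t) \<longlonglongrightarrow> f t))"

definition is_pettis_int :: "(real \<Rightarrow> 'a::real_normed_vector) \<Rightarrow> (real \<Rightarrow> real) \<Rightarrow> 'a \<Rightarrow> bool" where
  "is_pettis_int f g x \<longleftrightarrow> (\<forall>\<phi> :: 'a \<Rightarrow> real. bounded_linear \<phi> \<longrightarrow>
      \<phi> x = (LINT t:{0<..<1}|lborel. \<phi> (f t) * g t))"

definition I_op :: "(real \<Rightarrow> 'a::real_normed_vector) \<Rightarrow> (real \<Rightarrow> real) \<Rightarrow> 'a" where
  "I_op f g = (THE x. is_pettis_int f g x)"

definition gamma_fun_space :: "(real \<Rightarrow> 'a::real_normed_vector) set" where
  "gamma_fun_space = {f. strongly_measurable_01 f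
      \<and> (\<forall>\<phi> :: 'a \<Rightarrow> real. bounded_linear \<phi> \<longrightarrow> L2_01 (\<lambda>t. \<phi> (f t)))
      \<and> (\<forall>g. L2_01 g \<longrightarrow> (\<exists>x. is_pettis_int f g x))
      \<and> gamma_op (I_op f)}"

definition gamma_fun_norm :: "(real \<Rightarrow> 'a::real_normed_vector) \<Rightarrow> real" where
  "gamma_fun_norm f = gamma_op_norm (I_op f)"

end

theory Submission
  imports Defs
begin

text \<open>
  Given \<open>x\<^sub>0, \<dots>, x\<^sub>N\<^sub>-\<^sub>1\<close>, split \<open>[0,1]\<close> into consecutive intervals of length \<open>w\<^sub>n\<close>
  comparable from below with \<open>\<parallel>x\<^sub>n\<parallel>\<^sup>p / (\<Sum> \<parallel>x\<^sub>k\<parallel>\<^sup>p)\<close>, let \<open>e\<^sub>n\<close> be the \<open>L\<^sup>2\<close>-normalised tent function on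
  the \<open>n\<close>-th interval, and test the embedding on \<open>f = \<Sum> e\<^sub>n x\<^sub>n\<close>. The slope of \<open>e\<^sub>n\<close> is of order
  \<open>w\<^sub>n powr (-3/2)\<close>, so, since \<open>\<alpha> < 1/p - 1/2\<close>, the \<open>\<alpha>\<close>-Hoelder norm of \<open>f\<close> is at most a constant times
  \<open>(\<Sum> \<parallel>x\<^sub>k\<parallel>\<^sup>p) powr (1/p)\<close>. On the other hand \<open>I\<^sub>f\<close> maps the orthonormal system \<open>(\<epsilon>\<^sub>n e\<^sub>n)\<close> to
  \<open>(\<epsilon>\<^sub>n x\<^sub>n)\<close> for all signs \<open>\<epsilon>\<^sub>n\<close>, so the \<open>\<gamma>\<close>-norm of \<open>f\<close> dominates all Gaussian sums of
  \<open>(\<epsilon>\<^sub>n x\<^sub>n)\<close>. Averaging over the signs and using Jensen's inequality for \<open>\<bar>\<gamma>\<^sub>n\<bar>\<close> gives the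
  Rademacher sum.
\<close>

section \<open>Norming functionals\<close>

text \<open>Hahn--Banach by Zorn's lemma applied to sublinear functionals: if \<open>q\<close> is pointwise minimal, then
  it cannot be lowered in any direction \<open>y\<close>, so \<open>q (- y) = - q y\<close> and \<open>q\<close> is linear.\<close>

definition sublinear_le_norm :: "('a::real_normed_vector \<Rightarrow> real) \<Rightarrow> bool" where
  "sublinear_le_norm q \<longleftrightarrow> (\<forall>x y. q (x + y) \<le> q x + q y)
     \<and> (\<forall>c x. 0 \<le> c \<longrightarrow> q (c *\<^sub>R x) = c * q x) \<and> (\<forall>x. q x \<le> norm x)"

lemma sublinear_le_normD:
  assumes "sublinear_le_norm q"
  shows "q (x + y) \<le> q x + q y" "0 \<le> c \<Longrightarrow> q (c *\<^sub>R x) = c * q x" "q x \<le> norm x"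
    "q 0 = 0" "- q (- x) \<le> q x" "- norm x \<le> q x"
proof -
  note q = assms[unfolded sublinear_le_norm_def]
  show "q (x + y) \<le> q x + q y" "0 \<le> c \<Longrightarrow> q (c *\<^sub>R x) = c * q x" "q x \<le> norm x"
    using q by auto
  have "q (0 *\<^sub>R x) = 0 * q x" using q by blast
  then show q0: "q 0 = 0" by simp
  have "q (x + - x) \<le> q x + q (- x)" using q by blast
  then show "- q (- x) \<le> q x" by (simp add: q0)
  moreover have "q (- x) \<le> norm (- x)" using q by blast
  ultimately show "- norm x \<le> q x" by simp
qed

text \<open>The inequality for \<open>c\<close> and the one for \<open>inverse c\<close> at
  \<open>c *\<^sub>R x\<close> combine to equality, so positive homogeneity has to be checked in one
  direction only.\<close>

lemma sublinear_le_normI: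
  assumes "\<And>x y. q (x + y) \<le> q x + q y"
    and "q 0 = 0" "\<And>c x. 0 < c \<Longrightarrow> q (c *\<^sub>R x) \<le> c * q x"
    and "\<And>x. q x \<le> norm x"
  shows "sublinear_le_norm q"
proof -
  have "q (c *\<^sub>R x) = c * q x" if "0 \<le> c" for c x
  proof (cases "c = 0")
    case False
    with that have c: "0 < c" by simp
    from assms(3)[of "inverse c" "c *\<^sub>R x"] c have "c * q x \<le> q (c *\<^sub>R x)"
      by (simp add: field_simps)
    with assms(3)[OF c, of x] show ?thesis by simp
  qed (simp add: assms(2))
  with assms(1,4) show ?thesis unfolding sublinear_le_norm_def by blast
qed

text \<open>The witness is the largest sublinear functional below \<open>q\<close> whose value at
  \<open>- y\<close> is at most \<open>- q y\<close>: an infimum over all shifts along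
  \<open>y\<close>, each paid for by \<open>t * q y\<close>.\<close>

lemma sublinear_le_norm_lower:
  assumes q: "sublinear_le_norm q"
  obtains r where "sublinear_le_norm r" "\<And>z. r z \<le> q z" "r (- y) \<le> - q y"
proof -
  define r where "r z = (INF t\<in>{0::real..}. q (z + t *\<^sub>R y) - t * q y)" for z
  have bdd: "bdd_below ((\<lambda>t. q (z + t *\<^sub>R y) - t * q y) ` {0..})" for z
  proof (rule bdd_belowI2)
    fix t :: real assume "t \<in> {0..}"
    then have "t * q y = q ((z + t *\<^sub>R y) + - z)"
      using sublinear_le_normD(2)[OF q, of t y] by simp
    also have "\<dots> \<le> q (z + t *\<^sub>R y) + q (- z)" by (rule sublinear_le_normD(1)[OF q])
    finally show "- q (- z) \<le> q (z + t *\<^sub>R y) - t * q y" by simp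
  qed
  have le: "r z \<le> q (z + t *\<^sub>R y) - t * q y" if "0 \<le> t" for z t
    unfolding r_def by (rule cINF_lower[OF bdd]) (use that in simp)
  have ge: "a \<le> r z" if "\<And>t. 0 \<le> t \<Longrightarrow> a \<le> q (z + t *\<^sub>R y) - t * q y" for a z
    unfolding r_def by (rule cINF_greatest) (use that in auto)
  have rq: "r z \<le> q z" for z using le[of 0 z] by simp
  show thesis
  proof
    show "r z \<le> q z" for z by (rule rq)
    show "r (- y) \<le> - q y" using le[of 1 "- y"] by (simp add: sublinear_le_normD(4)[OF q])
    show "sublinear_le_norm r"
    proof (rule sublinear_le_normI)
      fix x z
      have "r (x + z) - r x \<le> r z"
      proof (rule ge)
        fix t :: real assume t: "0 \<le> t"
        have "r (x + z) - (q (z + t *\<^sub>R y) - t * q y) \<le> r x"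
        proof (rule ge)
          fix s :: real assume s: "0 \<le> s"
          \<comment> \<open>The parameter \<open>s + t\<close> for \<open>x + z\<close> is split as
            \<open>s\<close> for \<open>x\<close> and \<open>t\<close> for \<open>z\<close>.\<close>
          have "r (x + z) \<le> q ((x + z) + (s + t) *\<^sub>R y) - (s + t) * q y"
            using s t by (intro le) simp
          also have "(x + z) + (s + t) *\<^sub>R y = (x + s *\<^sub>R y) + (z + t *\<^sub>R y)"
            by (simp add: algebra_simps)
          finally show "r (x + z) - (q (z + t *\<^sub>R y) - t * q y) \<le> q (x + s *\<^sub>R y) - s * q y"
            using sublinear_le_normD(1)[OF q, of "x + s *\<^sub>R y" "z + t *\<^sub>R y"]
            by (simp add: algebra_simps)
        qed
        then show "r (x + z) - r x \<le> q (z + t *\<^sub>R y) - t * q y" by simp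
      qed
      then show "r (x + z) \<le> r x + r z" by simp
    next
      have "0 \<le> r 0" by (rule ge) (simp add: sublinear_le_normD(2)[OF q])
      then show "r 0 = 0" using rq[of 0] by (simp add: sublinear_le_normD(4)[OF q])
    next
      fix c :: real and x assume c: "0 < c"
      have "r (c *\<^sub>R x) / c \<le> r x"
      proof (rule ge)
        fix t :: real assume t: "0 \<le> t"
        have "r (c *\<^sub>R x) \<le> q (c *\<^sub>R x + (c * t) *\<^sub>R y) - (c * t) * q y"
          using c t by (intro le) simp
        also have "c *\<^sub>R x + (c * t) *\<^sub>R y = c *\<^sub>R (x + t *\<^sub>R y)" by (simp add: algebra_simps)
        also have "q \<dots> = c * q (x + t *\<^sub>R y)" using c by (intro sublinear_le_normD(2)[OF q]) simp
        finally show "r (c *\<^sub>R x) / c \<le> q (x + t *\<^sub>R y) - t * q y"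
          using c by (simp add: field_simps)
      qed
      then show "r (c *\<^sub>R x) \<le> c * r x" using c by (simp add: field_simps)
    next
      show "r x \<le> norm x" for x using rq[of x] sublinear_le_normD(3)[OF q, of x] by linarith
    qed
  qed
qed

text \<open>An infimum of sublinear functionals need not be subadditive. Along a chain it is,
  because two members \<open>q\<close> and \<open>r\<close> can both be replaced by the smaller one.
  The common lower bound \<open>- norm x\<close> keeps the infima finite.\<close>

lemma sublinear_le_norm_chain_Inf:
  assumes C: "\<And>q. q \<in> C \<Longrightarrow> sublinear_le_norm q" "C \<noteq> {}"
    and chain: "\<And>q r. q \<in> C \<Longrightarrow> r \<in> C \<Longrightarrow> (\<forall>x. q x \<le> r x) \<or> (\<forall>x. r x \<le> q x)"
  shows "sublinear_le_norm (\<lambda>x. INF q\<in>C. q x)" "q \<in> C \<Longrightarrow> (INF q\<in>C. q x) \<le> q x"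
proof -
  have bdd: "bdd_below ((\<lambda>q. q x) ` C)" for x
    by (rule bdd_belowI2[of _ "- norm x"]) (use sublinear_le_normD(6)[OF C(1)] in auto)
  define u where "u x = (INF q\<in>C. q x)" for x
  have le: "u x \<le> q x" if "q \<in> C" for q x
    unfolding u_def by (rule cINF_lower[OF bdd that])
  then show "q \<in> C \<Longrightarrow> (INF q\<in>C. q x) \<le> q x" unfolding u_def .
  have ge: "a \<le> u x" if "\<And>q. q \<in> C \<Longrightarrow> a \<le> q x" for a x
    unfolding u_def by (rule cINF_greatest[OF C(2)]) (rule that)
  obtain q0 where q0: "q0 \<in> C" using C(2) by blast
  have "sublinear_le_norm u"
  proof (rule sublinear_le_normI)
    fix x y
    have "u (x + y) - u x \<le> u y"
    proof (rule ge)
      fix q assume q: "q \<in> C"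
      have "u (x + y) - q y \<le> u x"
      proof (rule ge)
        fix r assume r: "r \<in> C"
        obtain m where m: "m \<in> C" "\<forall>x. m x \<le> q x" "\<forall>x. m x \<le> r x"
          using chain[OF q r] q r by blast
        have "u (x + y) \<le> m (x + y)" by (rule le[OF m(1)])
        also have "\<dots> \<le> m x + m y" by (rule sublinear_le_normD(1)[OF C(1)[OF m(1)]])
        also have "\<dots> \<le> r x + q y" using m by (intro add_mono) auto
        finally show "u (x + y) - q y \<le> r x" by simp
      qed
      then show "u (x + y) - u x \<le> q y" by simp
    qed
    then show "u (x + y) \<le> u x + u y" by simp
  next
    have "0 \<le> u 0" by (rule ge) (simp add: sublinear_le_normD(4)[OF C(1)])
    then show "u 0 = 0" using le[OF q0, of 0] by (simp add: sublinear_le_normD(4)[OF C(1)[OF q0]])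
  next
    fix c :: real and x assume c: "0 < c"
    have "u (c *\<^sub>R x) / c \<le> u x"
    proof (rule ge)
      fix q assume q: "q \<in> C"
      show "u (c *\<^sub>R x) / c \<le> q x"
        using le[OF q, of "c *\<^sub>R x"] sublinear_le_normD(2)[OF C(1)[OF q], of c x] c
        by (simp add: field_simps)
    qed
    then show "u (c *\<^sub>R x) \<le> c * u x" using c by (simp add: field_simps)
  next
    show "u x \<le> norm x" for x
      using le[OF q0, of x] sublinear_le_normD(3)[OF C(1)[OF q0], of x] by linarith
  qed
  then show "sublinear_le_norm (\<lambda>x. INF q\<in>C. q x)" unfolding u_def .
qed

text \<open>Minimality makes \<open>q\<close> linear but does not yet make it attain the norm at
  \<open>x\<close>. Hence the search starts from some \<open>p\<close> below \<open>norm\<close>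
  with \<open>p (- x) \<le> - norm x\<close>; a linear \<open>q\<close> below \<open>p\<close> then
  satisfies \<open>norm x \<le> q x\<close>.\<close>

lemma norming_functional:
  fixes x :: "'a::real_normed_vector"
  obtains \<phi> :: "'a \<Rightarrow> real"
  where "bounded_linear \<phi>" "\<And>y. \<bar>\<phi> y\<bar> \<le> norm y" "\<phi> x = norm x"
proof -
  have "sublinear_le_norm (norm :: 'a \<Rightarrow> real)"
    unfolding sublinear_le_norm_def by (auto intro: norm_triangle_ineq)
  then obtain p where p: "sublinear_le_norm p" "p (- x) \<le> - norm x"
    using sublinear_le_norm_lower[of norm x] by metis
  define A where "A = {q. sublinear_le_norm q \<and> (\<forall>y. q y \<le> p y)}"
  \<comment> \<open>The order is reversed: Zorn's lemma yields a \<open>P\<close>-maximal element,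
    which is a pointwise minimal functional.\<close>
  define P :: "('a \<Rightarrow> real) \<Rightarrow> ('a \<Rightarrow> real) \<Rightarrow> bool" where "P q r \<longleftrightarrow> (\<forall>y. r y \<le> q y)" for q r
  have "\<exists>m\<in>A. \<forall>a\<in>A. P m a \<longrightarrow> a = m"
  proof (rule predicate_Zorn)
    show "partial_order_on A (relation_of P A)"
      by (rule partial_order_on_relation_ofI)
        (auto simp: P_def fun_eq_iff intro: order_trans order.antisym)
  next
    fix C assume "C \<in> Chains (relation_of P A)"
    then have C: "C \<subseteq> A" "\<And>q r. q \<in> C \<Longrightarrow> r \<in> C \<Longrightarrow> (\<forall>x. q x \<le> r x) \<or> (\<forall>x. r x \<le> q x)"
      unfolding Chains_def relation_of_def P_def by auto
    show "\<exists>u\<in>A. \<forall>a\<in>C. P a u"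
    proof (cases "C = {}")
      case True
      then show ?thesis using p(1) unfolding A_def by auto
    next
      case False
      have S: "sublinear_le_norm q" if "q \<in> C" for q using C(1) that unfolding A_def by auto
      let ?u = "\<lambda>x. INF q\<in>C. q x"
      have u: "sublinear_le_norm ?u"
        by (rule sublinear_le_norm_chain_Inf(1)[where C = C]; fact S False C(2))
      have le: "?u y \<le> q y" if "q \<in> C" for q y
        by (rule sublinear_le_norm_chain_Inf(2)[where C = C]; fact S False C(2) that)
      obtain q0 where q0: "q0 \<in> C" using False by blast
      have "?u y \<le> p y" for y
      proof -
        have "q0 y \<le> p y" using C(1) q0 unfolding A_def by blast
        with le[OF q0, of y] show ?thesis by (rule order_trans)
      qed
      then have "?u \<in> A" unfolding A_def using u by blast
      moreover have "P q ?u" if "q \<in> C" for q unfolding P_def using le[OF that] by blast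
      ultimately show ?thesis by blast
    qed
  qed
  then obtain q where qA: "q \<in> A" and qmin: "\<And>r. r \<in> A \<Longrightarrow> P q r \<Longrightarrow> r = q" by blast
  have q: "sublinear_le_norm q" "\<And>y. q y \<le> p y" using qA unfolding A_def by auto
  \<comment> \<open>Minimality within \<open>A\<close> is minimality among all sublinear
    functionals, since whatever lies below \<open>q\<close> also lies below
    \<open>p\<close>.\<close>
  have min: "r = q" if r: "sublinear_le_norm r" "\<And>y. r y \<le> q y" for r
  proof (rule qmin)
    show "r \<in> A" unfolding A_def using r q(2) by (auto intro: order_trans)
    show "P q r" unfolding P_def using r(2) by blast
  qed
  have neg: "q (- y) = - q y" for y
  proof -
    obtain r where r: "sublinear_le_norm r" "\<And>z. r z \<le> q z" "r (- y) \<le> - q y"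
      using sublinear_le_norm_lower[OF q(1), of y] by metis
    then have "q (- y) \<le> - q y" using min by blast
    with sublinear_le_normD(5)[OF q(1), of y] show ?thesis by simp
  qed
  have add: "q (y + z) = q y + q z" for y z
    using sublinear_le_normD(1)[OF q(1), of y z] sublinear_le_normD(1)[OF q(1), of "- y" "- z"]
      neg[of "y + z"] neg[of y] neg[of z] by simp
  have scale: "q (c *\<^sub>R y) = c * q y" for c y
  proof (cases "0 \<le> c")
    case True then show ?thesis by (rule sublinear_le_normD(2)[OF q(1)])
  next
    case False
    then have "q ((- c) *\<^sub>R y) = (- c) * q y" by (intro sublinear_le_normD(2)[OF q(1)]) simp
    then show ?thesis using neg[of "c *\<^sub>R y"] by simp
  qed
  show thesis
  proof
    show abs: "\<bar>q y\<bar> \<le> norm y" for y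
      using sublinear_le_normD(3,6)[OF q(1), of y] by (simp add: abs_le_iff)
    show "bounded_linear q"
      by (rule bounded_linear_intro[of _ 1]) (use add scale abs in auto)
    show "q x = norm x"
      using q(2)[of "- x"] p(2) neg[of x] sublinear_le_normD(3)[OF q(1), of x] by simp
  qed
qed

text \<open>A norming functional for \<open>x - y\<close> separates. This gives uniqueness of the
  Pettis integral, so that the \<open>THE\<close> in \<open>I_op\<close> can be evaluated.\<close>

lemma bounded_linear_functionals_separate:
  fixes x y :: "'a::real_normed_vector"
  assumes "\<And>\<phi> :: 'a \<Rightarrow> real. bounded_linear \<phi> \<Longrightarrow> \<phi> x = \<phi> y"
  shows "x = y"
proof -
  obtain \<phi> :: "'a \<Rightarrow> real" where \<phi>: "bounded_linear \<phi>" "\<phi> (x - y) = norm (x - y)"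
    using norming_functional by metis
  then have "\<phi> (x - y) = \<phi> x - \<phi> y" by (simp add: linear_diff bounded_linear.linear)
  with \<phi>(2) assms[OF \<phi>(1)] show ?thesis by simp
qed

section \<open>Gaussian sums\<close>

text \<open>The space need not be second countable, so sums of measurable functions with values in it
  need not be measurable; the coefficients are routed through the space of real sequences instead.\<close>

lemma borel_measurable_norm_sum_scaleR:
  fixes x :: "nat \<Rightarrow> 'a::real_normed_vector"
  assumes "\<And>n. n < N \<Longrightarrow> a n \<in> borel_measurable M"
  shows "(\<lambda>\<omega>. norm (\<Sum>n<N. a n \<omega> *\<^sub>R x n)) \<in> borel_measurable M"
proof -
  define h where "h \<omega> n = (if n < N then a n \<omega> else 0)" for \<omega> n
  have h: "h \<in> borel_measurable M"
  proof (rule measurable_coordinatewise_then_product)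
    show "(\<lambda>\<omega>. h \<omega> n) \<in> borel_measurable M" for n
      by (cases "n < N") (simp_all add: h_def assms)
  qed
  have "continuous_on UNIV (\<lambda>v :: nat \<Rightarrow> real. norm (\<Sum>n<N. v n *\<^sub>R x n))"
    by (intro continuous_intros continuous_on_product_coordinates)
  then have "(\<lambda>v :: nat \<Rightarrow> real. norm (\<Sum>n<N. v n *\<^sub>R x n)) \<in> borel_measurable borel"
    by (rule borel_measurable_continuous_onI)
  from measurable_compose[OF h this] show ?thesis by (simp add: h_def)
qed

text \<open>Triangle inequality and Cauchy-Schwarz. The factor \<open>N\<close> does no harm: the
  bound serves integrability, finiteness and convergence for fixed \<open>N\<close> and never enters
  the type constant.\<close>

lemma norm_sum_scaleR_sq_le:
  fixes x :: "nat \<Rightarrow> 'a::real_normed_vector"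
  shows "(norm (\<Sum>n<N. a n *\<^sub>R x n))\<^sup>2 \<le> real N * (\<Sum>n<N. (norm (x n))\<^sup>2 * (a n)\<^sup>2)"
proof -
  have "(norm (\<Sum>n<N. a n *\<^sub>R x n))\<^sup>2 \<le> (\<Sum>n<N. norm (a n *\<^sub>R x n))\<^sup>2"
    by (intro power_mono norm_sum) simp
  also have "\<dots> \<le> (\<Sum>n<N. (norm (a n *\<^sub>R x n))\<^sup>2) * real (card {..<N})"
    by (rule sum_squared_le_sum_of_squares)
  finally show ?thesis by (simp add: power_mult_distrib mult.commute)
qed

text \<open>General coefficients \<open>a n\<close> cover both the Gaussian coordinates and their
  absolute values.\<close>

lemma integrable_norm_sum_scaleR_sq:
  fixes x :: "nat \<Rightarrow> 'a::real_normed_vector"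
  assumes meas: "\<And>n. n < N \<Longrightarrow> a n \<in> borel_measurable M"
    and int: "\<And>n. n < N \<Longrightarrow> integrable M (\<lambda>\<omega>. (a n \<omega>)\<^sup>2)"
  shows "integrable M (\<lambda>\<omega>. (norm (\<Sum>n<N. a n \<omega> *\<^sub>R x n))\<^sup>2)"
proof (rule Bochner_Integration.integrable_bound)
  show "integrable M (\<lambda>\<omega>. real N * (\<Sum>n<N. (norm (x n))\<^sup>2 * (a n \<omega>)\<^sup>2))"
    using int by auto
  show "(\<lambda>\<omega>. (norm (\<Sum>n<N. a n \<omega> *\<^sub>R x n))\<^sup>2) \<in> borel_measurable M"
    by (intro borel_measurable_power borel_measurable_norm_sum_scaleR meas)
  show "AE \<omega> in M. norm ((norm (\<Sum>n<N. a n \<omega> *\<^sub>R x n))\<^sup>2)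
      \<le> norm (real N * (\<Sum>n<N. (norm (x n))\<^sup>2 * (a n \<omega>)\<^sup>2))"
    by (intro AE_I2) (use norm_sum_scaleR_sq_le in \<open>fastforce intro: order_trans\<close>)
qed

section \<open>Moments of the standard Gaussian vector\<close>

interpretation gaussian: prob_space "density lborel std_normal_density"
  by (rule prob_space_normal_density) simp

interpretation gaussian_product: product_prob_space "\<lambda>_ :: nat. density lborel std_normal_density" UNIV
  by unfold_locales

lemma prob_space_std_gaussian_vec: "prob_space (std_gaussian_vec N)"
  unfolding std_gaussian_vec_def by (rule prob_space_PiM) (rule gaussian.prob_space_axioms)

lemma measurable_std_gaussian_vec_component:
  "n < N \<Longrightarrow> (\<lambda>\<omega>. \<omega> n) \<in> borel_measurable (std_gaussian_vec N)"
  unfolding std_gaussian_vec_def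
  using measurable_component_singleton[of n "{..<N}" "\<lambda>_. density lborel std_normal_density"]
  by (simp cong: measurable_cong_sets)

lemma std_gaussian_vec_prod:
  assumes "\<And>i. i < N \<Longrightarrow> integrable (density lborel std_normal_density) (f i :: real \<Rightarrow> real)"
  shows "integrable (std_gaussian_vec N) (\<lambda>\<omega>. \<Prod>i<N. f i (\<omega> i))"
    and "(\<integral>\<omega>. (\<Prod>i<N. f i (\<omega> i)) \<partial>std_gaussian_vec N)
      = (\<Prod>i<N. \<integral>t. f i t \<partial>density lborel std_normal_density)"
  unfolding std_gaussian_vec_def
  by (rule gaussian_product.product_integrable_prod gaussian_product.product_integral_prod;
      use assms in simp)+

lemma std_gaussian_vec_correlation:
  assumes n: "n < N" and m: "m < N"
  shows "integrable (std_gaussian_vec N) (\<lambda>\<omega>. \<omega> n * \<omega> m)"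
    and "(\<integral>\<omega>. \<omega> n * \<omega> m \<partial>std_gaussian_vec N) = (if n = m then 1 else 0)"
proof -
  \<comment> \<open>Two separate factors treat both cases at once: for \<open>n = m\<close> one
    coordinate carries \<open>t * t\<close>, otherwise two coordinates carry \<open>t\<close> each
    and their zero means annihilate the product.\<close>
  define f :: "nat \<Rightarrow> real \<Rightarrow> real"
    where "f i t = (if i = n then t else 1) * (if i = m then t else 1)" for i t
  have mom: "integrable (density lborel std_normal_density) (\<lambda>t. t)"
    "integrable (density lborel std_normal_density) (\<lambda>t. t * t)"
    "(\<integral>t. t \<partial>density lborel std_normal_density) = 0"
    "(\<integral>t. t * t \<partial>density lborel std_normal_density) = 1"
    using integrable_std_normal_distribution_moment[of 1]
      integrable_std_normal_distribution_moment[of 2]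
      integral_std_normal_distribution_moment_odd[of 1]
      std_normal_distribution_even_moments(1)[of 1]
    by (simp_all add: power2_eq_square)
  have int: "integrable (density lborel std_normal_density) (f i)" for i
    unfolding f_def using mom by (cases "i = n"; cases "i = m") simp_all
  have eq: "(\<Prod>i<N. f i (\<omega> i)) = \<omega> n * \<omega> m" for \<omega>
    unfolding f_def prod.distrib using n m by (simp add: prod.delta)
  have one: "(\<integral>t. f i t \<partial>density lborel std_normal_density) = (if n \<noteq> m \<and> (i = n \<or> i = m) then 0 else 1)" for i
    unfolding f_def using mom gaussian.prob_space by (cases "i = n"; cases "i = m") simp_all
  show "integrable (std_gaussian_vec N) (\<lambda>\<omega>. \<omega> n * \<omega> m)"
    using std_gaussian_vec_prod(1)[of N f] int by (simp add: eq)
  have "(\<integral>\<omega>. \<omega> n * \<omega> m \<partial>std_gaussian_vec N)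
      = (\<Prod>i<N. if n \<noteq> m \<and> (i = n \<or> i = m) then 0 else (1::real))"
    using std_gaussian_vec_prod(2)[of N f] int by (simp add: eq one)
  also have "\<dots> = (if n = m then 1 else 0)" using n by (auto intro!: prod_zero)
  finally show "(\<integral>\<omega>. \<omega> n * \<omega> m \<partial>std_gaussian_vec N) = (if n = m then 1 else 0)" .
qed

text \<open>This first absolute moment is the source of the factor \<open>pi / 2\<close> in the
  comparison of Rademacher and Gaussian sums.\<close>

lemma std_gaussian_vec_abs:
  assumes n: "n < N"
  shows "integrable (std_gaussian_vec N) (\<lambda>\<omega>. \<bar>\<omega> n\<bar>)"
    and "(\<integral>\<omega>. \<bar>\<omega> n\<bar> \<partial>std_gaussian_vec N) = sqrt (2 / pi)"
proof -
  define f :: "nat \<Rightarrow> real \<Rightarrow> real" where "f i t = (if i = n then \<bar>t\<bar> else 1)" for i t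
  have mom: "integrable (density lborel std_normal_density) (\<lambda>t. \<bar>t\<bar>)"
    "(\<integral>t. \<bar>t\<bar> \<partial>density lborel std_normal_density) = sqrt (2 / pi)"
    using integrable_std_normal_distribution_moment[of 1]
      std_normal_distribution_odd_moments_abs[of 0]
    by simp_all
  have int: "integrable (density lborel std_normal_density) (f i)" for i
    unfolding f_def using mom by (cases "i = n") simp_all
  have eq: "(\<Prod>i<N. f i (\<omega> i)) = \<bar>\<omega> n\<bar>" for \<omega>
    unfolding f_def using n by (simp add: prod.delta)
  have one: "(\<integral>t. f i t \<partial>density lborel std_normal_density) = (if i = n then sqrt (2 / pi) else 1)" for i
    unfolding f_def using mom gaussian.prob_space by (cases "i = n") simp_all
  show "integrable (std_gaussian_vec N) (\<lambda>\<omega>. \<bar>\<omega> n\<bar>)"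
    using std_gaussian_vec_prod(1)[of N f] int by (simp add: eq)
  show "(\<integral>\<omega>. \<bar>\<omega> n\<bar> \<partial>std_gaussian_vec N) = sqrt (2 / pi)"
    using std_gaussian_vec_prod(2)[of N f] int n by (simp add: eq one prod.delta)
qed

section \<open>Second moments of vector-valued Gaussian sums\<close>

lemma integrable_gauss_sq:
  "integrable (std_gaussian_vec N) (\<lambda>\<omega>. (norm (\<Sum>n<N. \<omega> n *\<^sub>R x n))\<^sup>2)"
  by (rule integrable_norm_sum_scaleR_sq)
    (use measurable_std_gaussian_vec_component std_gaussian_vec_correlation(1)
      in \<open>auto simp: power2_eq_square\<close>)

lemma gauss_sq_nonneg: "0 \<le> gauss_sq N x"
  unfolding gauss_sq_def by simp

lemma std_gaussian_vec_linear_sq: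
  shows "integrable (std_gaussian_vec N) (\<lambda>\<omega>. (\<Sum>n<N. \<omega> n * c n)\<^sup>2)"
    and "(\<integral>\<omega>. (\<Sum>n<N. \<omega> n * c n)\<^sup>2 \<partial>std_gaussian_vec N) = (\<Sum>n<N. (c n)\<^sup>2)"
proof -
  have eq: "(\<Sum>n<N. \<omega> n * c n)\<^sup>2 = (\<Sum>n<N. \<Sum>m<N. (\<omega> n * \<omega> m) * (c n * c m))" for \<omega>
    by (simp add: power2_eq_square sum_product mult_ac)
  show "integrable (std_gaussian_vec N) (\<lambda>\<omega>. (\<Sum>n<N. \<omega> n * c n)\<^sup>2)"
    unfolding eq by (auto intro!: Bochner_Integration.integrable_sum std_gaussian_vec_correlation(1))
  have "(\<integral>\<omega>. (\<Sum>n<N. \<omega> n * c n)\<^sup>2 \<partial>std_gaussian_vec N)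
      = (\<Sum>n<N. \<integral>\<omega>. (\<Sum>m<N. (\<omega> n * \<omega> m) * (c n * c m)) \<partial>std_gaussian_vec N)"
    unfolding eq
    by (rule Bochner_Integration.integral_sum)
      (auto intro!: Bochner_Integration.integrable_sum std_gaussian_vec_correlation(1))
  also have "\<dots> = (\<Sum>n<N. \<Sum>m<N. (\<integral>\<omega>. \<omega> n * \<omega> m \<partial>std_gaussian_vec N) * (c n * c m))"
    by (intro sum.cong refl, subst Bochner_Integration.integral_sum)
      (auto intro: std_gaussian_vec_correlation(1))
  also have "\<dots> = (\<Sum>n<N. \<Sum>m<N. if n = m then c n * c m else 0)"
    by (intro sum.cong refl) (simp add: std_gaussian_vec_correlation(2))
  also have "\<dots> = (\<Sum>n<N. (c n)\<^sup>2)" by (simp add: sum.delta' power2_eq_square)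
  finally show "(\<integral>\<omega>. (\<Sum>n<N. \<omega> n * c n)\<^sup>2 \<partial>std_gaussian_vec N) = (\<Sum>n<N. (c n)\<^sup>2)" .
qed

text \<open>After exchanging the sums, the coefficient of \<open>x n\<close> is a linear combination
  of Gaussians whose second moment is the sum of the squared \<open>c m n\<close>. For a finite rank
  operator these are inner products, to which Bessel's inequality applies.\<close>

lemma gauss_sq_matrix_le:
  "gauss_sq M (\<lambda>m. \<Sum>n<N. c m n *\<^sub>R x n)
    \<le> real N * (\<Sum>n<N. (norm (x n))\<^sup>2 * (\<Sum>m<M. (c m n)\<^sup>2))"
proof -
  have eq: "(\<Sum>m<M. \<omega> m *\<^sub>R (\<Sum>n<N. c m n *\<^sub>R x n)) = (\<Sum>n<N. (\<Sum>m<M. \<omega> m * c m n) *\<^sub>R x n)"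
    for \<omega> :: "nat \<Rightarrow> real"
    unfolding scaleR_sum_right scaleR_sum_left by (subst sum.swap) simp
  have "gauss_sq M (\<lambda>m. \<Sum>n<N. c m n *\<^sub>R x n) \<le> (\<integral>\<omega>. real N *
      (\<Sum>n<N. (norm (x n))\<^sup>2 * (\<Sum>m<M. \<omega> m * c m n)\<^sup>2) \<partial>std_gaussian_vec M)"
    unfolding gauss_sq_def
  proof (rule integral_mono[OF integrable_gauss_sq])
    show "integrable (std_gaussian_vec M)
        (\<lambda>\<omega>. real N * (\<Sum>n<N. (norm (x n))\<^sup>2 * (\<Sum>m<M. \<omega> m * c m n)\<^sup>2))"
      by (intro integrable_mult_right Bochner_Integration.integrable_sum std_gaussian_vec_linear_sq(1))
  qed (simp only: eq norm_sum_scaleR_sq_le)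
  also have "\<dots> = real N * (\<Sum>n<N. (norm (x n))\<^sup>2 * (\<Sum>m<M. (c m n)\<^sup>2))"
    by (simp add: Bochner_Integration.integral_sum std_gaussian_vec_linear_sq)
  finally show ?thesis .
qed

lemma gauss_sq_le: "gauss_sq N x \<le> real N * (\<Sum>n<N. (norm (x n))\<^sup>2)"
proof -
  have "gauss_sq N (\<lambda>m. \<Sum>n<N. (if m = n then 1 else 0) *\<^sub>R x n)
      \<le> real N * (\<Sum>n<N. (norm (x n))\<^sup>2 * (\<Sum>m<N. (if m = n then 1 else 0)\<^sup>2))"
    by (rule gauss_sq_matrix_le)
  moreover have "gauss_sq N (\<lambda>m. \<Sum>n<N. (if m = n then 1 else 0) *\<^sub>R x n) = gauss_sq N x"
    unfolding gauss_sq_def by (simp add: if_distrib[of "\<lambda>c. c *\<^sub>R _"] sum.delta' cong: if_cong)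
  moreover have "(\<Sum>m<N. (if m = n then 1 else 0 :: real)\<^sup>2) = 1" if "n < N" for n
    using that by (simp add: if_distrib[of "\<lambda>c. c\<^sup>2"] sum.delta cong: if_cong)
  ultimately show ?thesis by simp
qed

text \<open>Minkowski's inequality in \<open>L^2\<close>, obtained from Young's inequality with
  weights \<open>b / a\<close> and \<open>a / b\<close>. With these weights the right-hand side is
  exactly \<open>(a + b)\<^sup>2\<close>.\<close>

lemma gauss_sq_add_le:
  assumes a: "0 < a" "gauss_sq N x \<le> a\<^sup>2" and b: "0 < b" "gauss_sq N y \<le> b\<^sup>2"
  shows "gauss_sq N (\<lambda>n. x n + y n) \<le> (a + b)\<^sup>2"
proof -
  define X Y where "X \<omega> = norm (\<Sum>n<N. \<omega> n *\<^sub>R x n)" and "Y \<omega> = norm (\<Sum>n<N. \<omega> n *\<^sub>R y n)"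
    for \<omega> :: "nat \<Rightarrow> real"
  have young: "(s + t)\<^sup>2 \<le> (1 + b / a) * s\<^sup>2 + (1 + a / b) * t\<^sup>2" for s t :: real
  proof -
    have "0 \<le> (b * s - a * t)\<^sup>2 / (a * b)" using a b by simp
    also have "\<dots> = (1 + b / a) * s\<^sup>2 + (1 + a / b) * t\<^sup>2 - (s + t)\<^sup>2"
      using a(1) b(1) by (simp add: power2_eq_square field_simps)
    finally show ?thesis by simp
  qed
  have int: "integrable (std_gaussian_vec N) (\<lambda>\<omega>. (X \<omega>)\<^sup>2)" "integrable (std_gaussian_vec N) (\<lambda>\<omega>. (Y \<omega>)\<^sup>2)"
    unfolding X_def Y_def by (rule integrable_gauss_sq)+
  have "gauss_sq N (\<lambda>n. x n + y n)
      \<le> (\<integral>\<omega>. (1 + b / a) * (X \<omega>)\<^sup>2 + (1 + a / b) * (Y \<omega>)\<^sup>2 \<partial>std_gaussian_vec N)"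
    unfolding gauss_sq_def
  proof (rule integral_mono[OF integrable_gauss_sq])
    show "integrable (std_gaussian_vec N) (\<lambda>\<omega>. (1 + b / a) * (X \<omega>)\<^sup>2 + (1 + a / b) * (Y \<omega>)\<^sup>2)"
      using int by simp
    fix \<omega> :: "nat \<Rightarrow> real"
    have "(norm (\<Sum>n<N. \<omega> n *\<^sub>R (x n + y n)))\<^sup>2 \<le> (X \<omega> + Y \<omega>)\<^sup>2"
      unfolding X_def Y_def
      by (intro power_mono) (auto simp: scaleR_add_right sum.distrib intro: norm_triangle_ineq)
    also note young
    finally show "(norm (\<Sum>n<N. \<omega> n *\<^sub>R (x n + y n)))\<^sup>2
      \<le> (1 + b / a) * (X \<omega>)\<^sup>2 + (1 + a / b) * (Y \<omega>)\<^sup>2" .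
  qed
  also have "\<dots> = (1 + b / a) * gauss_sq N x + (1 + a / b) * gauss_sq N y"
    using int by (simp add: X_def Y_def gauss_sq_def)
  also have "\<dots> \<le> (1 + b / a) * a\<^sup>2 + (1 + a / b) * b\<^sup>2"
    using a b by (intro add_mono mult_left_mono) auto
  also have "\<dots> = (a + b)\<^sup>2" using a(1) b(1) by (simp add: power2_eq_square field_simps)
  finally show ?thesis .
qed

text \<open>Enlarging each root by \<open>e / 2\<close> makes it positive, as the weights
  \<open>b / a\<close> and \<open>a / b\<close> of \<open>gauss_sq_add_le\<close> demand, even when
  a Gaussian sum vanishes.\<close>

lemma sqrt_gauss_sq_triangle:
  "sqrt (gauss_sq N (\<lambda>n. x n + y n)) \<le> sqrt (gauss_sq N x) + sqrt (gauss_sq N y)"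
proof (rule field_le_epsilon)
  fix e :: real assume e: "0 < e"
  have *: "gauss_sq N z \<le> (sqrt (gauss_sq N z) + e / 2)\<^sup>2" for z :: "nat \<Rightarrow> 'a"
  proof -
    have "gauss_sq N z = (sqrt (gauss_sq N z))\<^sup>2" by (simp add: gauss_sq_nonneg)
    also have "\<dots> \<le> (sqrt (gauss_sq N z) + e / 2)\<^sup>2"
      using e by (intro power_mono) (auto simp: gauss_sq_nonneg)
    finally show ?thesis .
  qed
  have "gauss_sq N (\<lambda>n. x n + y n)
      \<le> ((sqrt (gauss_sq N x) + e / 2) + (sqrt (gauss_sq N y) + e / 2))\<^sup>2"
    by (rule gauss_sq_add_le) (use e * in \<open>auto simp: gauss_sq_nonneg add_nonneg_pos\<close>)
  then have "sqrt (gauss_sq N (\<lambda>n. x n + y n))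
      \<le> (sqrt (gauss_sq N x) + e / 2) + (sqrt (gauss_sq N y) + e / 2)"
    by (intro real_le_lsqrt) (use e in \<open>auto simp: gauss_sq_nonneg\<close>)
  then show "sqrt (gauss_sq N (\<lambda>n. x n + y n)) \<le> sqrt (gauss_sq N x) + sqrt (gauss_sq N y) + e"
    by simp
qed

section \<open>Comparison of Rademacher sums with Gaussian sums\<close>

lemma norm_sq_le_integral_abs_gaussian:
  fixes x :: "nat \<Rightarrow> 'a::real_normed_vector"
  shows "2 / pi * (norm (\<Sum>n<N. x n))\<^sup>2
    \<le> (\<integral>\<omega>. (norm (\<Sum>n<N. \<bar>\<omega> n\<bar> *\<^sub>R x n))\<^sup>2 \<partial>std_gaussian_vec N)"
proof -
  interpret G: prob_space "std_gaussian_vec N" by (rule prob_space_std_gaussian_vec)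
  obtain \<phi> :: "'a \<Rightarrow> real" where \<phi>: "bounded_linear \<phi>" "\<And>y. \<bar>\<phi> y\<bar> \<le> norm y"
    "\<phi> (\<Sum>n<N. x n) = norm (\<Sum>n<N. x n)"
    using norming_functional by metis
  interpret bounded_linear \<phi> by (rule \<phi>(1))
  \<comment> \<open>Jensen's inequality is reduced to the scalar variable \<open>?V\<close> by a
    norming functional of the full sum; \<open>a\<close> is the mean of \<open>?V\<close>.\<close>
  define a where "a = sqrt (2 / pi) * norm (\<Sum>n<N. x n)"
  let ?V = "\<lambda>\<omega>. \<Sum>n<N. \<bar>\<omega> n\<bar> * \<phi> (x n)"
  have int: "integrable (std_gaussian_vec N) (\<lambda>\<omega>. 2 * a * ?V \<omega> - a\<^sup>2)"
    by (auto intro!: Bochner_Integration.integrable_diff integrable_mult_right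
        Bochner_Integration.integrable_sum std_gaussian_vec_abs(1))
  have "(\<integral>\<omega>. ?V \<omega> \<partial>std_gaussian_vec N) = (\<Sum>n<N. sqrt (2 / pi) * \<phi> (x n))"
    by (subst Bochner_Integration.integral_sum) (auto simp: std_gaussian_vec_abs)
  also have "\<dots> = a"
    by (simp add: a_def \<phi>(3)[symmetric] sum sum_distrib_left)
  finally have V: "(\<integral>\<omega>. ?V \<omega> \<partial>std_gaussian_vec N) = a" .
  have "2 / pi * (norm (\<Sum>n<N. x n))\<^sup>2 = a\<^sup>2"
    by (simp add: a_def power_mult_distrib)
  also have "\<dots> = 2 * a * (\<integral>\<omega>. ?V \<omega> \<partial>std_gaussian_vec N) - a\<^sup>2"
    unfolding V by (simp add: power2_eq_square)
  also have "\<dots> = (\<integral>\<omega>. 2 * a * ?V \<omega> - a\<^sup>2 \<partial>std_gaussian_vec N)"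
    by (subst Bochner_Integration.integral_diff)
      (auto intro!: Bochner_Integration.integrable_sum std_gaussian_vec_abs(1) simp: G.prob_space)
  also have "\<dots> \<le> (\<integral>\<omega>. (norm (\<Sum>n<N. \<bar>\<omega> n\<bar> *\<^sub>R x n))\<^sup>2 \<partial>std_gaussian_vec N)"
  proof (rule integral_mono[OF int])
    show "integrable (std_gaussian_vec N) (\<lambda>\<omega>. (norm (\<Sum>n<N. \<bar>\<omega> n\<bar> *\<^sub>R x n))\<^sup>2)"
      by (rule integrable_norm_sum_scaleR_sq)
        (use measurable_std_gaussian_vec_component std_gaussian_vec_correlation(1)
          in \<open>auto simp: power2_eq_square\<close>)
    fix \<omega> :: "nat \<Rightarrow> real"
    have "?V \<omega> = \<phi> (\<Sum>n<N. \<bar>\<omega> n\<bar> *\<^sub>R x n)" by (simp add: sum scaleR)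
    then have "(?V \<omega>)\<^sup>2 \<le> (norm (\<Sum>n<N. \<bar>\<omega> n\<bar> *\<^sub>R x n))\<^sup>2"
      using \<phi>(2) by (metis norm_ge_zero power2_abs power_mono abs_ge_zero)
    \<comment> \<open>This is the tangent line bound for the square at the mean \<open>a\<close>;
      integrating it gives Jensen's inequality.\<close>
    moreover have "0 \<le> (?V \<omega> - a)\<^sup>2" by simp
    ultimately show "2 * a * ?V \<omega> - a\<^sup>2 \<le> (norm (\<Sum>n<N. \<bar>\<omega> n\<bar> *\<^sub>R x n))\<^sup>2"
      by (simp add: power2_diff algebra_simps)
  qed
  finally show ?thesis .
qed

text \<open>Multiplication by the signs of \<open>\<omega>\<close> is an involution of the set of
  sign vectors, so it only permutes the summands.\<close>

lemma sum_signs_abs: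
  fixes \<omega> :: "nat \<Rightarrow> real" and x :: "nat \<Rightarrow> 'a::real_normed_vector"
  shows "(\<Sum>\<epsilon>\<in>{..<N} \<rightarrow>\<^sub>E {-1, 1::real}. (norm (\<Sum>n<N. \<bar>\<omega> n\<bar> *\<^sub>R \<epsilon> n *\<^sub>R x n))\<^sup>2)
    = (\<Sum>\<epsilon>\<in>{..<N} \<rightarrow>\<^sub>E {-1, 1::real}. (norm (\<Sum>n<N. \<omega> n *\<^sub>R \<epsilon> n *\<^sub>R x n))\<^sup>2)"
proof -
  \<comment> \<open>The value at \<open>\<omega> n = 0\<close> is \<open>1\<close> rather than
    \<open>0\<close>, so that \<open>s n\<close> is always a sign.\<close>
  define s :: "nat \<Rightarrow> real" where "s n = (if \<omega> n < 0 then -1 else 1)" for n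
  have s: "s n = - 1 \<or> s n = 1" "\<omega> n * s n = \<bar>\<omega> n\<bar>" "s n * (s n * c) = c" for n c
    by (auto simp: s_def)
  let ?i = "\<lambda>\<epsilon>. \<lambda>n\<in>{..<N}. s n * \<epsilon> n"
  show ?thesis
  proof (rule sum.reindex_bij_witness[of _ ?i ?i])
    fix \<epsilon> :: "nat \<Rightarrow> real" assume \<epsilon>: "\<epsilon> \<in> {..<N} \<rightarrow>\<^sub>E {-1, 1}"
    show "?i (?i \<epsilon>) = \<epsilon>"
      using \<epsilon> by (auto simp: fun_eq_iff restrict_def s PiE_def extensional_def)
    show "?i \<epsilon> \<in> {..<N} \<rightarrow>\<^sub>E {-1, 1}"
    proof (intro restrict_PiE_iff[THEN iffD2] ballI)
      fix n assume "n \<in> {..<N}"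
      then have "\<epsilon> n = -1 \<or> \<epsilon> n = 1" using \<epsilon> by (auto simp: PiE_def Pi_def)
      then show "s n * \<epsilon> n \<in> {-1, 1}" using s(1)[of n] by auto
    qed
    then show "?i \<epsilon> \<in> {..<N} \<rightarrow>\<^sub>E {-1, 1}" .
    show "?i (?i \<epsilon>) = \<epsilon>" by fact
    have "(\<Sum>n<N. \<omega> n *\<^sub>R ?i \<epsilon> n *\<^sub>R x n) = (\<Sum>n<N. \<bar>\<omega> n\<bar> *\<^sub>R \<epsilon> n *\<^sub>R x n)"
      by (intro sum.cong refl) (simp add: s(2)[symmetric] mult.assoc)
    then show "(norm (\<Sum>n<N. \<omega> n *\<^sub>R ?i \<epsilon> n *\<^sub>R x n))\<^sup>2 = (norm (\<Sum>n<N. \<bar>\<omega> n\<bar> *\<^sub>R \<epsilon> n *\<^sub>R x n))\<^sup>2"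
      by simp
  qed
qed

text \<open>Jensen's inequality is applied to each sign vector with the weights
  \<open>\<bar>\<omega> n\<bar>\<close>. The sum over all sign vectors, taken under the integral,
  then turns \<open>\<bar>\<omega> n\<bar>\<close> back into \<open>\<omega> n\<close>.\<close>

lemma rademacher_sq_le_gauss_sq:
  fixes x :: "nat \<Rightarrow> 'a::real_normed_vector"
  assumes K: "\<And>\<epsilon>. \<epsilon> \<in> {..<N} \<rightarrow>\<^sub>E {-1, 1} \<Longrightarrow> gauss_sq N (\<lambda>n. \<epsilon> n *\<^sub>R x n) \<le> K"
  shows "rademacher_sq N x \<le> pi / 2 * K"
proof -
  let ?S = "{..<N} \<rightarrow>\<^sub>E {-1, 1::real}"
  have card: "card ?S = 2 ^ N" by (simp add: card_PiE numeral_2_eq_2)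
  have "2 / pi * (\<Sum>\<epsilon>\<in>?S. (norm (\<Sum>n<N. \<epsilon> n *\<^sub>R x n))\<^sup>2)
      \<le> (\<Sum>\<epsilon>\<in>?S. \<integral>\<omega>. (norm (\<Sum>n<N. \<bar>\<omega> n\<bar> *\<^sub>R \<epsilon> n *\<^sub>R x n))\<^sup>2 \<partial>std_gaussian_vec N)"
    unfolding sum_distrib_left by (intro sum_mono norm_sq_le_integral_abs_gaussian)
  also have "\<dots> = (\<integral>\<omega>. (\<Sum>\<epsilon>\<in>?S. (norm (\<Sum>n<N. \<bar>\<omega> n\<bar> *\<^sub>R \<epsilon> n *\<^sub>R x n))\<^sup>2) \<partial>std_gaussian_vec N)"
    by (rule Bochner_Integration.integral_sum[symmetric], rule integrable_norm_sum_scaleR_sq)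
      (use measurable_std_gaussian_vec_component std_gaussian_vec_correlation(1)
        in \<open>auto simp: power2_eq_square\<close>)
  also have "\<dots> = (\<Sum>\<epsilon>\<in>?S. gauss_sq N (\<lambda>n. \<epsilon> n *\<^sub>R x n))"
    unfolding sum_signs_abs gauss_sq_def
    by (rule Bochner_Integration.integral_sum, rule integrable_gauss_sq)
  also have "\<dots> \<le> real (card ?S) * K" by (rule sum_bounded_above) (rule K)
  finally show ?thesis
    unfolding rademacher_sq_def card by (simp add: field_simps)
qed

section \<open>The gamma-norm\<close>

abbreviation lborel01 :: "real measure" where
  "lborel01 \<equiv> restrict_space lborel {0<..<1}"

lemma L2_01_iff:
  "L2_01 g \<longleftrightarrow> g \<in> borel_measurable lborel01 \<and> integrable lborel01 (\<lambda>t. (g t)\<^sup>2)"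
  unfolding L2_01_def by (simp add: set_integrable_eq)

lemma l2ip_eq: "l2ip g h = (\<integral>t. g t * h t \<partial>lborel01)"
  unfolding l2ip_def by (simp add: set_lebesgue_integral_def integral_restrict_space)

lemma l2ip_commute: "l2ip g h = l2ip h g"
  unfolding l2ip_def by (simp add: mult.commute)

lemma L2_01_integrable_mult:
  assumes "L2_01 g" "L2_01 h"
  shows "integrable lborel01 (\<lambda>t. g t * h t)"
proof (rule Bochner_Integration.integrable_bound)
  show "integrable lborel01 (\<lambda>t. (g t)\<^sup>2 + (h t)\<^sup>2)"
    using assms by (simp add: L2_01_iff)
  show "(\<lambda>t. g t * h t) \<in> borel_measurable lborel01"
    using assms by (auto simp: L2_01_iff intro: borel_measurable_times)
  have "\<bar>g t * h t\<bar> \<le> (g t)\<^sup>2 + (h t)\<^sup>2" for t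
  proof -
    have "0 \<le> (\<bar>g t\<bar> - \<bar>h t\<bar>)\<^sup>2" by simp
    then have "2 * (\<bar>g t\<bar> * \<bar>h t\<bar>) \<le> (g t)\<^sup>2 + (h t)\<^sup>2" by (simp add: power2_diff)
    moreover have "0 \<le> \<bar>g t\<bar> * \<bar>h t\<bar>" by simp
    ultimately show ?thesis unfolding abs_mult by linarith
  qed
  then show "AE t in lborel01. norm (g t * h t) \<le> norm ((g t)\<^sup>2 + (h t)\<^sup>2)"
    by simp
qed

lemma L2_01_cmult:
  assumes "L2_01 g"
  shows "L2_01 (\<lambda>t. c * g t)"
  using assms by (auto simp: L2_01_iff power_mult_distrib intro: borel_measurable_times)

lemma l2ip_sum_left:
  assumes "\<And>k. k < N \<Longrightarrow> L2_01 (e k)" "L2_01 g"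
  shows "l2ip (\<lambda>t. \<Sum>k<N. c k * e k t) g = (\<Sum>k<N. c k * l2ip (e k) g)"
  unfolding l2ip_eq sum_distrib_right mult.assoc
  by (subst Bochner_Integration.integral_sum)
    (use assms L2_01_integrable_mult in \<open>auto\<close>)

lemma l2ip_cmult_right: "l2ip g (\<lambda>t. c * h t) = c * l2ip g h"
  unfolding l2ip_eq by (simp add: mult.left_commute)

lemma l2ip_cmult_left: "l2ip (\<lambda>t. c * g t) h = c * l2ip g h"
  unfolding l2ip_eq by (simp add: mult.assoc)

lemma orthonormal_sysD:
  assumes "orthonormal_sys N e"
  shows "n < N \<Longrightarrow> L2_01 (e n)"
    and "m < N \<Longrightarrow> n < N \<Longrightarrow> l2ip (e m) (e n) = (if m = n then 1 else 0)"
  using assms unfolding orthonormal_sys_def by auto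

lemma Bessel_inequality:
  assumes e: "orthonormal_sys M e" and h: "L2_01 h"
  shows "(\<Sum>m<M. (l2ip (e m) h)\<^sup>2) \<le> l2ip h h"
proof -
  define c where "c m = l2ip (e m) h" for m
  \<comment> \<open>The orthogonal projection of \<open>h\<close> onto the span of the system; the
    claim follows by expanding the squared distance from \<open>h\<close> to
    \<open>P\<close>.\<close>
  define P where "P t = (\<Sum>m<M. c m * e m t)" for t
  have eL: "L2_01 (e m)" if "m < M" for m using orthonormal_sysD(1)[OF e that] .
  have Peq: "P t * g t = (\<Sum>m<M. c m * (e m t * g t))" for g t
    unfolding P_def by (simp add: sum_distrib_right mult.assoc)
  have intP: "integrable lborel01 (\<lambda>t. P t * g t)" if "L2_01 g" for g
    unfolding Peq using L2_01_integrable_mult[OF eL that] by auto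
  have L2P: "L2_01 P"
  proof -
    have "(P t)\<^sup>2 = (\<Sum>m<M. c m * (P t * e m t))" for t
      unfolding power2_eq_square by (subst (2) P_def) (simp add: sum_distrib_left mult_ac)
    moreover have "P \<in> borel_measurable lborel01"
      unfolding P_def using eL
      by (intro borel_measurable_sum borel_measurable_times) (auto simp: L2_01_iff)
    ultimately show ?thesis unfolding L2_01_iff using intP[OF eL] by auto
  qed
  have Ph: "l2ip P h = (\<Sum>m<M. (c m)\<^sup>2)"
    using l2ip_sum_left[of M e h c] eL h by (simp add: P_def[abs_def] c_def power2_eq_square)
  have Pe: "l2ip (e k) P = c k" if "k < M" for k
  proof -
    have "l2ip P (e k) = (\<Sum>m<M. c m * l2ip (e m) (e k))"
      using l2ip_sum_left[of M e "e k" c] eL that by (simp add: P_def[abs_def])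
    also have "\<dots> = (\<Sum>m<M. if m = k then c m else 0)"
      using that by (intro sum.cong refl) (simp add: orthonormal_sysD(2)[OF e])
    also have "\<dots> = c k" using that by simp
    finally show ?thesis by (simp only: l2ip_commute)
  qed
  have "l2ip P P = (\<Sum>m<M. c m * l2ip (e m) P)"
    using l2ip_sum_left[of M e P c] eL L2P by (simp only: P_def[abs_def])
  then have PP: "l2ip P P = (\<Sum>m<M. (c m)\<^sup>2)"
    by (simp add: Pe power2_eq_square)
  have "0 \<le> (\<integral>t. (h t - P t)\<^sup>2 \<partial>lborel01)" by simp
  also have "\<dots> = (\<integral>t. h t * h t - 2 * (P t * h t) + P t * P t \<partial>lborel01)"
    by (rule arg_cong[where f = "integral\<^sup>L _"]) (simp add: fun_eq_iff power2_eq_square algebra_simps)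
  also have "\<dots> = l2ip h h - 2 * l2ip P h + l2ip P P"
    using L2_01_integrable_mult[OF h h] intP[OF h] intP[OF L2P] by (simp add: l2ip_eq)
  finally show ?thesis unfolding Ph PP by (simp add: c_def)
qed

section \<open>The gamma-norm and its limits\<close>

text \<open>\<open>gnorm\<close> is a supremum of reals and bounds its members only if they are
  bounded above; this condition therefore accompanies the estimates from above by
  \<open>gnorm\<close>.\<close>

definition gnorm_bounded :: "((real \<Rightarrow> real) \<Rightarrow> 'a::real_normed_vector) \<Rightarrow> bool" where
  "gnorm_bounded T \<longleftrightarrow> (\<exists>B. \<forall>N e. orthonormal_sys N e \<longrightarrow> sqrt (gauss_sq N (\<lambda>n. T (e n))) \<le> B)"

lemma gnorm_upper:
  assumes "gnorm_bounded T" "orthonormal_sys N e"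
  shows "sqrt (gauss_sq N (\<lambda>n. T (e n))) \<le> gnorm T"
proof -
  obtain B where "orthonormal_sys N e \<Longrightarrow> sqrt (gauss_sq N (\<lambda>n. T (e n))) \<le> B" for N e
    using assms(1) unfolding gnorm_bounded_def by blast
  then have "bdd_above ((\<lambda>(N, e). sqrt (gauss_sq N (\<lambda>n. T (e n)))) ` {(N, e). orthonormal_sys N e})"
    by (intro bdd_aboveI2[of _ _ B]) auto
  from cSUP_upper[OF _ this, of "(N, e)"] show ?thesis
    using assms(2) unfolding gnorm_def by simp
qed

lemma gnorm_least:
  assumes "\<And>N e. orthonormal_sys N e \<Longrightarrow> sqrt (gauss_sq N (\<lambda>n. T (e n))) \<le> c"
  shows "gnorm T \<le> c"
  unfolding gnorm_def
proof (rule cSUP_least)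
  have "orthonormal_sys 0 (\<lambda>_ _. 0)" by (simp add: orthonormal_sys_def)
  then show "{(N, e). orthonormal_sys N e} \<noteq> {}" by blast
qed (use assms in auto)

text \<open>Bessel's inequality for the testing system \<open>e\<close> bounds the squared
  coefficients of each \<open>h n\<close> by \<open>1\<close>, uniformly in the size of
  \<open>e\<close>.\<close>

lemma finite_rank_op_gnorm_bounded:
  assumes "finite_rank_op R"
  shows "gnorm_bounded R"
proof -
  obtain N h x where h: "orthonormal_sys N h"
    and R: "\<And>g. L2_01 g \<Longrightarrow> R g = (\<Sum>n<N. l2ip g (h n) *\<^sub>R x n)"
    using assms unfolding finite_rank_op_def by blast
  have "gauss_sq M (\<lambda>m. R (e m)) \<le> real N * (\<Sum>n<N. (norm (x n))\<^sup>2)"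
    if e: "orthonormal_sys M e" for M e
  proof -
    have "gauss_sq M (\<lambda>m. R (e m)) = gauss_sq M (\<lambda>m. \<Sum>n<N. l2ip (e m) (h n) *\<^sub>R x n)"
      unfolding gauss_sq_def using R[OF orthonormal_sysD(1)[OF e]] by simp
    also have "\<dots> \<le> real N * (\<Sum>n<N. (norm (x n))\<^sup>2 * (\<Sum>m<M. (l2ip (e m) (h n))\<^sup>2))"
      by (rule gauss_sq_matrix_le)
    also have "\<dots> \<le> real N * (\<Sum>n<N. (norm (x n))\<^sup>2 * 1)"
    proof (intro mult_left_mono sum_mono)
      fix n assume "n \<in> {..<N}"
      then show "(\<Sum>m<M. (l2ip (e m) (h n))\<^sup>2) \<le> 1"
        using Bessel_inequality[OF e, of "h n"] orthonormal_sysD[OF h] by simp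
    qed simp_all
    finally show ?thesis by simp
  qed
  then show ?thesis unfolding gnorm_bounded_def by (blast intro: real_sqrt_le_mono)
qed

lemma gnorm_diff_bounded:
  assumes "gnorm_bounded R" "gnorm_bounded S"
  shows "gnorm_bounded (\<lambda>g. R g - S g)"
proof -
  have "sqrt (gauss_sq N (\<lambda>n. R (e n) - S (e n))) \<le> gnorm R + gnorm S"
    if e: "orthonormal_sys N e" for N e
  proof -
    have "gauss_sq N (\<lambda>n. - S (e n)) = gauss_sq N (\<lambda>n. S (e n))"
      by (simp add: gauss_sq_def sum_negf)
    then show ?thesis
      using sqrt_gauss_sq_triangle[of N "\<lambda>n. R (e n)" "\<lambda>n. - S (e n)"]
        gnorm_upper[OF assms(1) e] gnorm_upper[OF assms(2) e] by simp
  qed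
  then show ?thesis unfolding gnorm_bounded_def by blast
qed

lemma gnorm_triangle:
  assumes "gnorm_bounded R" "gnorm_bounded S"
  shows "gnorm R \<le> gnorm S + gnorm (\<lambda>g. R g - S g)"
proof (rule gnorm_least)
  fix N e assume e: "orthonormal_sys N e"
  show "sqrt (gauss_sq N (\<lambda>n. R (e n))) \<le> gnorm S + gnorm (\<lambda>g. R g - S g)"
    using sqrt_gauss_sq_triangle[of N "\<lambda>n. S (e n)" "\<lambda>n. R (e n) - S (e n)"]
      gnorm_upper[OF assms(2) e] gnorm_upper[OF gnorm_diff_bounded[OF assms] e] by simp
qed

text \<open>Transfers pointwise convergence of operators to Gaussian sums over a fixed finite
  system, where the crude factor \<open>N\<close> is a constant.\<close>

lemma tendsto_gauss_sq_diff:
  assumes "\<And>n. n < N \<Longrightarrow> (\<lambda>k. y k n) \<longlonglongrightarrow> x n"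
  shows "(\<lambda>k. sqrt (gauss_sq N (\<lambda>n. x n - y k n))) \<longlonglongrightarrow> 0"
proof (rule real_tendsto_sandwich[of "\<lambda>_. 0"])
  have "(\<lambda>k. sqrt (real N * (\<Sum>n<N. (norm (x n - y k n))\<^sup>2)))
      \<longlonglongrightarrow> sqrt (real N * (\<Sum>n<N. (norm (x n - x n))\<^sup>2))"
    by (intro tendsto_intros assms) simp
  then show "(\<lambda>k. sqrt (real N * (\<Sum>n<N. (norm (x n - y k n))\<^sup>2))) \<longlonglongrightarrow> 0" by simp
qed (simp_all add: gauss_sq_nonneg gauss_sq_le)

text \<open>The reverse triangle inequality makes the norms a Cauchy sequence, so the
  \<open>lim\<close> in \<open>gamma_op_norm\<close> is a genuine limit.\<close>

lemma gamma_approx_convergent: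
  assumes "gamma_approx R T"
  shows "convergent (\<lambda>k. gnorm (R k))"
proof (rule Cauchy_convergent, rule CauchyI)
  have b: "gnorm_bounded (R k)" for k
    using assms finite_rank_op_gnorm_bounded unfolding gamma_approx_def by blast
  fix \<epsilon> :: real assume "0 < \<epsilon>"
  then obtain K where K: "\<And>k l. k \<ge> K \<Longrightarrow> l \<ge> K \<Longrightarrow> gnorm (\<lambda>g. R k g - R l g) < \<epsilon>"
    using assms unfolding gamma_approx_def by blast
  have "norm (gnorm (R k) - gnorm (R l)) < \<epsilon>" if "k \<ge> K" "l \<ge> K" for k l
    using gnorm_triangle[OF b b, of k l] gnorm_triangle[OF b b, of l k] K[OF that] K[OF that(2,1)]
    by (simp add: abs_less_iff)
  then show "\<exists>M. \<forall>m\<ge>M. \<forall>n\<ge>M. norm (gnorm (R m) - gnorm (R n)) < \<epsilon>" by blast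
qed

text \<open>On a fixed system \<open>T\<close> differs from \<open>R k\<close> by a Gaussian sum
  tending to \<open>0\<close>, and the part coming from \<open>R k\<close> is at most
  \<open>gnorm (R k)\<close>.\<close>

lemma gamma_approx_gauss_sq_le:
  assumes R: "gamma_approx R T" and e: "orthonormal_sys N e"
  shows "sqrt (gauss_sq N (\<lambda>n. T (e n))) \<le> lim (\<lambda>k. gnorm (R k))"
proof (rule LIMSEQ_le_const)
  let ?d = "\<lambda>k. sqrt (gauss_sq N (\<lambda>n. T (e n) - R k (e n)))"
  have "?d \<longlonglongrightarrow> 0"
    by (rule tendsto_gauss_sq_diff)
      (use R orthonormal_sysD(1)[OF e] in \<open>auto simp: gamma_approx_def\<close>)
  from tendsto_add[OF this convergent_LIMSEQ_iff[THEN iffD1, OF gamma_approx_convergent[OF R]]]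
  show "(\<lambda>k. ?d k + gnorm (R k)) \<longlonglongrightarrow> lim (\<lambda>k. gnorm (R k))" by simp
  have "sqrt (gauss_sq N (\<lambda>n. T (e n))) \<le> ?d k + gnorm (R k)" for k
  proof -
    have "gnorm_bounded (R k)"
      using R finite_rank_op_gnorm_bounded unfolding gamma_approx_def by blast
    from gnorm_upper[OF this e] show ?thesis
      using sqrt_gauss_sq_triangle[of N "\<lambda>n. T (e n) - R k (e n)" "\<lambda>n. R k (e n)"] by simp
  qed
  then show "\<exists>M. \<forall>k\<ge>M. sqrt (gauss_sq N (\<lambda>n. T (e n))) \<le> ?d k + gnorm (R k)" by blast
qed

text \<open>The preceding bound holds for every approximating sequence, hence for the one selected
  by \<open>SOME\<close>.\<close>

lemma gauss_sq_le_gamma_op_norm: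
  assumes "gamma_op T" "orthonormal_sys N e"
  shows "sqrt (gauss_sq N (\<lambda>n. T (e n))) \<le> gamma_op_norm T"
proof -
  have "gamma_approx (SOME R. gamma_approx R T) T"
    using assms(1) unfolding gamma_op_def by (rule someI_ex)
  then show ?thesis
    unfolding gamma_op_norm_def by (rule gamma_approx_gauss_sq_le[OF _ assms(2)])
qed

section \<open>The integral operator tested on orthonormal systems\<close>

text \<open>Under any functional orthonormality leaves only the \<open>n\<close>-th term, and
  functionals determine the integral. The scalar \<open>c\<close> makes room for the signs inserted
  later.\<close>

lemma I_op_orthonormal_sum:
  fixes x :: "nat \<Rightarrow> 'a::real_normed_vector"
  assumes e: "orthonormal_sys N e" and n: "n < N"
  shows "I_op (\<lambda>t. \<Sum>k<N. e k t *\<^sub>R x k) (\<lambda>t. c * e n t) = c *\<^sub>R x n"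
proof -
  let ?f = "\<lambda>t. \<Sum>k<N. e k t *\<^sub>R x k"
  have int: "(LINT t:{0<..<1}|lborel. \<phi> (?f t) * (c * e n t)) = \<phi> (c *\<^sub>R x n)"
    if "bounded_linear \<phi>" for \<phi> :: "'a \<Rightarrow> real"
  proof -
    interpret bounded_linear \<phi> by fact
    have "(LINT t:{0<..<1}|lborel. \<phi> (?f t) * (c * e n t))
        = l2ip (\<lambda>t. \<Sum>k<N. \<phi> (x k) * e k t) (\<lambda>t. c * e n t)"
      unfolding l2ip_def by (simp add: sum scaleR mult.commute)
    also have "\<dots> = (\<Sum>k<N. \<phi> (x k) * l2ip (e k) (\<lambda>t. c * e n t))"
      by (rule l2ip_sum_left) (use orthonormal_sysD(1)[OF e] n in \<open>auto intro: L2_01_cmult\<close>)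
    also have "\<dots> = (\<Sum>k<N. if k = n then c * \<phi> (x k) else 0)"
      unfolding l2ip_cmult_right
      by (intro sum.cong refl) (use n in \<open>simp add: orthonormal_sysD(2)[OF e]\<close>)
    also have "\<dots> = \<phi> (c *\<^sub>R x n)" using n by (simp add: scaleR)
    finally show ?thesis .
  qed
  show ?thesis
    unfolding I_op_def
  proof (rule the_equality)
    show "is_pettis_int ?f (\<lambda>t. c * e n t) (c *\<^sub>R x n)"
      unfolding is_pettis_int_def by (intro allI impI int[symmetric])
    fix y assume y: "is_pettis_int ?f (\<lambda>t. c * e n t) y"
    show "y = c *\<^sub>R x n"
    proof (rule bounded_linear_functionals_separate)
      fix \<phi> :: "'a \<Rightarrow> real" assume \<phi>: "bounded_linear \<phi>"
      then have "\<phi> y = (LINT t:{0<..<1}|lborel. \<phi> (?f t) * (c * e n t))"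
        using y unfolding is_pettis_int_def by blast
      then show "\<phi> y = \<phi> (c *\<^sub>R x n)" by (simp only: int[OF \<phi>])
    qed
  qed
qed

text \<open>Flipping signs in the orthonormal system replaces the symmetry of the Gaussian measure.\<close>

lemma gauss_sq_signs_le_gamma_fun_norm:
  fixes x :: "nat \<Rightarrow> 'a::real_normed_vector"
  assumes e: "orthonormal_sys N e"
    and f: "(\<lambda>t. \<Sum>k<N. e k t *\<^sub>R x k) \<in> gamma_fun_space"
    and \<epsilon>: "\<epsilon> \<in> {..<N} \<rightarrow>\<^sub>E {-1, 1}"
  shows "sqrt (gauss_sq N (\<lambda>n. \<epsilon> n *\<^sub>R x n)) \<le> gamma_fun_norm (\<lambda>t. \<Sum>k<N. e k t *\<^sub>R x k)"
proof -
  \<comment> \<open>This is why sign changes preserve orthonormality: the diagonal inner products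
    are multiplied by \<open>\<epsilon> n * \<epsilon> n\<close>, the others stay
    \<open>0\<close>.\<close>
  have sq: "\<epsilon> n * \<epsilon> n = 1" if "n < N" for n
    using \<epsilon> that by (fastforce simp: PiE_def Pi_def)
  have "orthonormal_sys N (\<lambda>n t. \<epsilon> n * e n t)"
    using e sq unfolding orthonormal_sys_def
    by (auto intro: L2_01_cmult simp: l2ip_cmult_left l2ip_cmult_right)
  from gauss_sq_le_gamma_op_norm[OF _ this, of "I_op (\<lambda>t. \<Sum>k<N. e k t *\<^sub>R x k)"] f
  have "sqrt (gauss_sq N (\<lambda>n. I_op (\<lambda>t. \<Sum>k<N. e k t *\<^sub>R x k) (\<lambda>t. \<epsilon> n * e n t)))
      \<le> gamma_fun_norm (\<lambda>t. \<Sum>k<N. e k t *\<^sub>R x k)"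
    unfolding gamma_fun_norm_def gamma_fun_space_def by blast
  then show ?thesis
    unfolding gauss_sq_def by (simp add: I_op_orthonormal_sum[OF e])
qed

section \<open>Tent functions and Hoelder norms\<close>

text \<open>Slopes are \<open>1\<close> and \<open>-1\<close> on every interval; the
  \<open>L^2\<close> normalisation is applied afterwards, in \<open>hoelder_tents\<close>.\<close>

definition tent :: "real \<Rightarrow> real \<Rightarrow> real \<Rightarrow> real" where
  "tent a b t = max 0 (min (t - a) (b - t))"

lemma tent_nonneg: "0 \<le> tent a b t"
  by (simp add: tent_def)

lemma tent_le: "a \<le> b \<Longrightarrow> tent a b t \<le> b - a"
  by (auto simp: tent_def min_def max_def)

lemma tent_nonzeroD: "tent a b t \<noteq> 0 \<Longrightarrow> a < t \<and> t < b"
  by (auto simp: tent_def min_def max_def split: if_splits)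

lemma tent_diff_le: "\<bar>tent a b t - tent a b s\<bar> \<le> \<bar>t - s\<bar>"
  by (auto simp: tent_def min_def max_def abs_if)

text \<open>Interpolation: the power \<alpha> of the Lipschitz bound times the power
  \<open>1 - \<alpha>\<close> of the sup bound \<open>b - a\<close>.\<close>

lemma tent_hoelder:
  assumes "a < b" "0 < \<alpha>" "\<alpha> < 1"
  shows "\<bar>tent a b t - tent a b s\<bar> \<le> \<bar>t - s\<bar> powr \<alpha> * (b - a) powr (1 - \<alpha>)"
proof -
  let ?d = "\<bar>tent a b t - tent a b s\<bar>"
  have "?d \<le> b - a"
    using tent_nonneg[of a b t] tent_nonneg[of a b s] tent_le[of a b t] tent_le[of a b s] assms
    by (simp add: abs_le_iff)
  have "?d = ?d powr \<alpha> * ?d powr (1 - \<alpha>)"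
    by (simp add: powr_add[symmetric])
  also have "\<dots> \<le> \<bar>t - s\<bar> powr \<alpha> * (b - a) powr (1 - \<alpha>)"
    using assms tent_diff_le \<open>?d \<le> b - a\<close>
    by (intro mult_mono powr_mono2) auto
  finally show ?thesis .
qed

lemma L2_01_tent:
  assumes "a \<le> b"
  shows "L2_01 (tent a b)"
proof -
  have "continuous_on UNIV (tent a b)"
    unfolding tent_def[abs_def] by (intro continuous_intros)
  then have meas: "tent a b \<in> borel_measurable lborel01"
    by (intro measurable_restrict_space1) (simp add: borel_measurable_continuous_onI)
  have fin: "emeasure lborel01 (space lborel01) < \<infinity>"
    by (simp add: emeasure_restrict_space space_restrict_space)
  interpret finite_measure lborel01
    by (rule finite_measureI) (use fin in simp)
  have "integrable lborel01 (\<lambda>t. (tent a b t)\<^sup>2)"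
  proof (rule integrable_const_bound[of _ "(b - a)\<^sup>2"])
    show "AE t in lborel01. norm ((tent a b t)\<^sup>2) \<le> (b - a)\<^sup>2"
      using tent_nonneg tent_le[OF assms] by (intro AE_I2) (simp add: power_mono)
  qed (use meas in \<open>auto intro: borel_measurable_power\<close>)
  with meas show ?thesis by (simp add: L2_01_iff)
qed

text \<open>On the middle half of the interval, of length \<open>w / 2\<close>, the tent is at least
  \<open>w / 4\<close>, and \<open>(w / 4)\<^sup>2 * (w / 2) = w ^ 3 / 32\<close>.\<close>

lemma l2ip_tent_ge:
  assumes "0 \<le> a" "a < b" "b \<le> 1"
  shows "(b - a) ^ 3 / 32 \<le> l2ip (tent a b) (tent a b)"
proof -
  define w where "w = b - a"
  have w: "0 < w" "b = a + w" using assms by (simp_all add: w_def)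
  define J where "J = {a + w / 4..b - w / 4}"
  have J: "J \<subseteq> {0<..<1}" unfolding J_def w(2) using assms w by auto
  have Jsets: "J \<in> sets lborel01"
    using J by (auto simp: sets_restrict_space_iff J_def)
  have "emeasure lborel01 J = emeasure lborel J"
    by (rule emeasure_restrict_space) (use J in auto)
  also have "\<dots> = ennreal (w / 2)" unfolding J_def using w by simp
  finally have emJ: "emeasure lborel01 J = ennreal (w / 2)" .
  then have mJ: "measure lborel01 J = w / 2" using w by (simp add: measure_def)
  have "w ^ 3 / 32 = (\<integral>t. (w / 4)\<^sup>2 * indicator J t \<partial>lborel01)"
    using Jsets emJ mJ J by (simp add: power2_eq_square power3_eq_cube Int_absorb2)
  also have "\<dots> \<le> (\<integral>t. tent a b t * tent a b t \<partial>lborel01)"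
  proof (rule integral_mono)
    show "integrable lborel01 (\<lambda>t. (w / 4)\<^sup>2 * indicator J t)"
      using Jsets emJ by (intro integrable_mult_right integrable_real_indicator) auto
    show "integrable lborel01 (\<lambda>t. tent a b t * tent a b t)"
      using L2_01_integrable_mult L2_01_tent assms by simp
    fix t
    show "(w / 4)\<^sup>2 * indicator J t \<le> tent a b t * tent a b t"
    proof (cases "t \<in> J")
      case True
      then have "w / 4 \<le> min (t - a) (b - t)" unfolding J_def by auto
      then have "w / 4 \<le> tent a b t" unfolding tent_def by (rule max.coboundedI2)
      then have "(w / 4) * (w / 4) \<le> tent a b t * tent a b t" using w by (intro mult_mono) auto
      then show ?thesis using True by (simp add: power2_eq_square)
    qed simp
  qed
  finally show ?thesis by (simp add: l2ip_eq w_def)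
qed

text \<open>Here \<open>u\<close> and \<open>v\<close> stand for the values at two points of
  functions with disjoint supports. Each point meets at most one support, so at most two summands
  survive, whatever the number of functions.\<close>

lemma norm_sum_le_two_supports:
  fixes y :: "nat \<Rightarrow> 'a::real_normed_vector"
  assumes "finite A" "\<And>m n. u m \<noteq> 0 \<Longrightarrow> u n \<noteq> 0 \<Longrightarrow> m = n" "\<And>m n. v m \<noteq> 0 \<Longrightarrow> v n \<noteq> 0 \<Longrightarrow> m = n"
    and "\<And>n. n \<in> A \<Longrightarrow> norm ((u n - v n) *\<^sub>R y n) \<le> B" "0 \<le> B"
  shows "norm (\<Sum>n\<in>A. (u n - v n) *\<^sub>R y n) \<le> 2 * (B :: real)"
proof -
  let ?U = "{n \<in> A. u n \<noteq> 0}" and ?V = "{n \<in> A. v n \<noteq> 0}"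
  have "card ?U \<le> 1" "card ?V \<le> 1"
    using assms(1-3) by (auto simp: card_le_Suc0_iff_eq)
  then have card: "card (?U \<union> ?V) \<le> 2" using card_Un_le[of ?U ?V] by linarith
  have "(\<Sum>n\<in>A. (u n - v n) *\<^sub>R y n) = (\<Sum>n\<in>?U \<union> ?V. (u n - v n) *\<^sub>R y n)"
    using assms(1) by (intro sum.mono_neutral_right) auto
  also have "norm \<dots> \<le> real (card (?U \<union> ?V)) * B"
    by (rule sum_norm_bound) (use assms(4) in auto)
  also have "\<dots> \<le> 2 * B" using card assms(5) by (intro mult_right_mono) auto
  finally show ?thesis .
qed

text \<open>Since \<open>f 0 = 0\<close>, the increment from \<open>0\<close> to \<open>t\<close>
  bounds the sup part by \<open>B\<close> as well, whence the factor \<open>2\<close>.\<close>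

lemma hoelder_spaceI:
  fixes f :: "real \<Rightarrow> 'a::real_normed_vector"
  assumes "0 < \<alpha>" "f 0 = 0" "0 \<le> B"
    and h: "\<And>s t. 0 \<le> s \<Longrightarrow> s < t \<Longrightarrow> t \<le> 1 \<Longrightarrow> norm (f t - f s) \<le> B * \<bar>t - s\<bar> powr \<alpha>"
  shows "f \<in> hoelder_space \<alpha>" "hoelder_norm \<alpha> f \<le> 2 * B" "0 \<le> hoelder_norm \<alpha> f"
proof -
  have sup: "r \<le> B" if "r \<in> sup_part f" for r
  proof -
    from that obtain t where t: "r = norm (f t)" "0 \<le> t" "t \<le> 1" unfolding sup_part_def by auto
    show ?thesis
    proof (cases "t = 0")
      case False
      then have "norm (f t) \<le> B * t powr \<alpha>" using h[of 0 t] t assms(2) by simp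
      also have "\<dots> \<le> B * 1"
        using t assms False by (intro mult_left_mono powr_le1) auto
      finally show ?thesis using t by simp
    qed (use t assms in simp)
  qed
  have hoe: "r \<le> B" if "r \<in> hoelder_part \<alpha> f" for r
    using that h unfolding hoelder_part_def by (auto simp: divide_le_eq)
  have ne: "norm (f 0) \<in> sup_part f" "norm (f 1 - f 0) / \<bar>1 - 0\<bar> powr \<alpha> \<in> hoelder_part \<alpha> f"
  proof -
    show "norm (f 0) \<in> sup_part f" unfolding sup_part_def by auto
    show "norm (f 1 - f 0) / \<bar>1 - 0\<bar> powr \<alpha> \<in> hoelder_part \<alpha> f"
      unfolding hoelder_part_def by (intro CollectI exI[of _ 0] exI[of _ 1]) simp
  qed
  have bdd: "bdd_above (sup_part f)" "bdd_above (hoelder_part \<alpha> f)"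
    using sup hoe unfolding bdd_above_def by blast+
  then show "f \<in> hoelder_space \<alpha>" unfolding hoelder_space_def by simp
  have "Sup (sup_part f) \<le> B"
    by (rule cSup_least) (use ne(1) sup in blast)+
  moreover have "Sup (hoelder_part \<alpha> f) \<le> B"
    by (rule cSup_least) (use ne(2) hoe in blast)+
  ultimately show "hoelder_norm \<alpha> f \<le> 2 * B" unfolding hoelder_norm_def by simp
  have "0 \<le> Sup (sup_part f)" "0 \<le> Sup (hoelder_part \<alpha> f)"
    by (rule order_trans[OF _ cSup_upper[OF ne(1) bdd(1)]] order_trans[OF _ cSup_upper[OF ne(2) bdd(2)]], simp)+
  then show "0 \<le> hoelder_norm \<alpha> f" unfolding hoelder_norm_def by simp
qed

text \<open>The powers of \<open>w n\<close> from the normalisation, the tent increment and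
  \<open>x n\<close> are \<open>- 3 / 2\<close>, \<open>1 - \<alpha>\<close> and
  \<open>1 / p\<close>. Their sum \<open>1 / p - 1 / 2 - \<alpha>\<close> is positive and
  \<open>w n \<le> 1\<close>, so short intervals cost nothing. In \<open>4 * sqrt 32\<close>, one
  factor \<open>2\<close> comes from the two supports and the other from adding sup and Hoelder
  parts.\<close>

lemma hoelder_tents:
  fixes x :: "nat \<Rightarrow> 'a::real_normed_vector"
  assumes p: "1 < p" and \<alpha>: "0 < \<alpha>" "\<alpha> < 1 / p - 1 / 2"
    and w: "\<And>n. n < N \<Longrightarrow> 0 < w n" "(\<Sum>n<N. w n) \<le> 1"
    and x: "\<And>n. n < N \<Longrightarrow> norm (x n) \<le> B * w n powr (1 / p)" and B: "0 \<le> B"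
  obtains e where "orthonormal_sys N e"
    "(\<lambda>t. \<Sum>n<N. e n t *\<^sub>R x n) \<in> hoelder_space \<alpha>"
    "hoelder_norm \<alpha> (\<lambda>t. \<Sum>n<N. e n t *\<^sub>R x n) \<le> 4 * sqrt 32 * B"
    "0 \<le> hoelder_norm \<alpha> (\<lambda>t. \<Sum>n<N. e n t *\<^sub>R x n)"
proof -
  have "1 / p < 1" using p by simp
  then have \<alpha>1: "\<alpha> < 1" using \<alpha> by linarith
  \<comment> \<open>The default length \<open>1\<close> from index \<open>N\<close> on keeps
    \<open>a\<close> monotone on all of the naturals, so disjointness of the supports holds without
    index bounds.\<close>
  define a where "a n = (\<Sum>i<n. if i < N then w i else 1)" for n
  have aSuc: "a (Suc n) = a n + w n" if "n < N" for n
    using that by (simp add: a_def)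
  have mono: "a m \<le> a n" if "m \<le> n" for m n
    unfolding a_def using that w(1) by (intro sum_mono2) (auto intro: less_imp_le)
  have a0: "0 \<le> a n" for n using mono[of 0 n] by (simp add: a_def)
  have a1: "a n \<le> 1" if "n \<le> N" for n
    using mono[OF that] w(2) by (simp add: a_def)
  define \<psi> where "\<psi> n = tent (a n) (a (Suc n))" for n
  have disj: "m = n" if "\<psi> m t \<noteq> 0" "\<psi> n t \<noteq> 0" for m n t
  proof (rule ccontr)
    assume "m \<noteq> n"
    then have "Suc m \<le> n \<or> Suc n \<le> m" by auto
    with mono[of "Suc m" n] mono[of "Suc n" m] tent_nonzeroD[OF that(1)[unfolded \<psi>_def]]
      tent_nonzeroD[OF that(2)[unfolded \<psi>_def]]
    show False by auto
  qed
  have L2: "L2_01 (\<psi> n)" for n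
    unfolding \<psi>_def by (intro L2_01_tent mono) simp
  define q where "q n = l2norm (\<psi> n)" for n
  have q: "w n powr (3 / 2) / sqrt 32 \<le> q n" "0 < q n" if n: "n < N" for n
  proof -
    have "w n ^ 3 / 32 \<le> l2ip (\<psi> n) (\<psi> n)"
      using l2ip_tent_ge[of "a n" "a (Suc n)"] a0 a1[of "Suc n"] w(1)[OF n] n
      by (simp add: \<psi>_def aSuc)
    then have "sqrt (w n ^ 3 / 32) \<le> q n" unfolding q_def l2norm_def by simp
    moreover have "sqrt (w n ^ 3) = w n powr (3 / 2)"
    proof -
      have "w n ^ 3 = w n powr 3" using powr_realpow[OF w(1)[OF n], of 3] by simp
      moreover have "sqrt (w n powr 3) = (w n powr 3) powr (1 / 2)" by (rule powr_half_sqrt[symmetric]) simp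
      ultimately show ?thesis by (simp add: powr_powr)
    qed
    ultimately show "w n powr (3 / 2) / sqrt 32 \<le> q n" by (simp only: real_sqrt_divide)
    moreover have "0 < w n powr (3 / 2) / sqrt 32" using w(1)[OF n] by simp
    ultimately show "0 < q n" by linarith
  qed
  define e where "e n t = 1 / q n * \<psi> n t" for n t
  have "l2ip (e m) (e n) = (if m = n then 1 else 0)" if "m < N" "n < N" for m n
  proof (cases "m = n")
    case True
    have "l2ip (e n) (e n) = 1 / q n * (1 / q n * l2ip (\<psi> n) (\<psi> n))"
      unfolding e_def l2ip_cmult_left l2ip_cmult_right by simp
    also have "l2ip (\<psi> n) (\<psi> n) = (q n)\<^sup>2"
      unfolding q_def l2norm_def by (simp add: l2ip_eq)
    finally show ?thesis using True q(2)[OF that(2)] by (simp add: power2_eq_square)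
  next
    case False
    then have "(\<lambda>t. e m t * e n t) = (\<lambda>t. 0)" using disj[of m _ n] by (auto simp: e_def fun_eq_iff)
    then show ?thesis using False unfolding l2ip_eq by simp
  qed
  moreover have "L2_01 (e n)" for n
    unfolding e_def[abs_def] by (rule L2_01_cmult[OF L2])
  ultimately have e: "orthonormal_sys N e" unfolding orthonormal_sys_def by simp
  have bound: "norm ((e n t - e n s) *\<^sub>R x n) \<le> sqrt 32 * B * \<bar>t - s\<bar> powr \<alpha>" if n: "n < N" for n s t
  proof -
    note wn = w(1)[OF n]
    have w1: "w n \<le> 1" using aSuc[OF n] a0[of n] a1[of "Suc n"] n by simp
    have "1 / q n \<le> sqrt 32 * w n powr (- (3 / 2))"
      using q[OF n] wn by (simp add: field_simps powr_minus)
    moreover have "\<bar>\<psi> n t - \<psi> n s\<bar> \<le> \<bar>t - s\<bar> powr \<alpha> * w n powr (1 - \<alpha>)"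
      using tent_hoelder[of "a n" "a (Suc n)" \<alpha> t s] wn \<alpha> \<alpha>1 by (simp add: \<psi>_def aSuc[OF n])
    ultimately have "1 / q n * \<bar>\<psi> n t - \<psi> n s\<bar> * norm (x n)
      \<le> (sqrt 32 * w n powr (- (3 / 2))) * (\<bar>t - s\<bar> powr \<alpha> * w n powr (1 - \<alpha>)) * (B * w n powr (1 / p))"
      using q[OF n] wn x[OF n] B by (intro mult_mono) auto
    also have "\<dots> = sqrt 32 * B * \<bar>t - s\<bar> powr \<alpha>
        * (w n powr (- (3 / 2)) * w n powr (1 - \<alpha>) * w n powr (1 / p))"
      by (simp only: mult_ac)
    \<comment> \<open>Here the exponents add up to the positive number provided by the upper bound
      on \<alpha>.\<close>
    also have "w n powr (- (3 / 2)) * w n powr (1 - \<alpha>) * w n powr (1 / p) = w n powr (1 / p - 1 / 2 - \<alpha>)"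
      unfolding powr_add[symmetric] by (simp add: algebra_simps)
    also have "sqrt 32 * B * \<bar>t - s\<bar> powr \<alpha> * w n powr (1 / p - 1 / 2 - \<alpha>)
        \<le> sqrt 32 * B * \<bar>t - s\<bar> powr \<alpha> * 1"
      using wn w1 \<alpha> B by (intro mult_left_mono powr_le1) auto
    finally have "1 / q n * \<bar>\<psi> n t - \<psi> n s\<bar> * norm (x n) \<le> sqrt 32 * B * \<bar>t - s\<bar> powr \<alpha>" by simp
    moreover have "norm ((e n t - e n s) *\<^sub>R x n) = 1 / q n * \<bar>\<psi> n t - \<psi> n s\<bar> * norm (x n)"
      using q(2)[OF n] by (simp add: e_def diff_divide_distrib[symmetric])
    ultimately show ?thesis by simp
  qed
  let ?f = "\<lambda>t. \<Sum>n<N. e n t *\<^sub>R x n"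
  have ediff: "norm (?f t - ?f s) \<le> 2 * sqrt 32 * B * \<bar>t - s\<bar> powr \<alpha>" for s t
  proof -
    have "norm (\<Sum>n<N. (e n t - e n s) *\<^sub>R x n) \<le> 2 * (sqrt 32 * B * \<bar>t - s\<bar> powr \<alpha>)"
      by (rule norm_sum_le_two_supports) (use bound disj B in \<open>auto simp: e_def\<close>)
    then show ?thesis by (simp add: scaleR_diff_left sum_subtractf)
  qed
  have "\<psi> n 0 = 0" for n using tent_nonzeroD[of "a n" "a (Suc n)" 0] a0[of n] by (auto simp: \<psi>_def)
  then have f0: "?f 0 = 0" by (simp add: e_def)
  have "0 \<le> 2 * sqrt 32 * B" using B by simp
  from hoelder_spaceI[OF \<alpha>(1) f0 this ediff] show thesis
    by (intro that[OF e]) simp_all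
qed

section \<open>Type p from the embedding\<close>

theorem theorem3p5:
  fixes p \<alpha> :: real
  assumes "1 < p" "p < 2"
    and "0 < \<alpha>" "\<alpha> < 1 / p - 1 / 2"
    and "hoelder_space \<alpha> \<subseteq> (gamma_fun_space :: (real \<Rightarrow> 'a::banach) set)"
    and "\<exists>C. \<forall>f \<in> (hoelder_space \<alpha> :: (real \<Rightarrow> 'a) set).
           gamma_fun_norm f \<le> C * hoelder_norm \<alpha> f"
  shows "has_type p TYPE('a)"
proof -
  obtain C where C: "\<And>f :: real \<Rightarrow> 'a. f \<in> hoelder_space \<alpha> \<Longrightarrow> gamma_fun_norm f \<le> C * hoelder_norm \<alpha> f"
    using assms(6) by blast
  \<comment> \<open>The embedding constant, made nonnegative by the absolute value, times the
    constant of \<open>hoelder_tents\<close>, times the factor \<open>2 powr (1 / p)\<close> left by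
    the denominator \<open>2 * S\<close> of the lengths.\<close>
  define D where "D = \<bar>C\<bar> * (4 * sqrt 32 * 2 powr (1 / p))"
  have D: "0 \<le> D" by (simp add: D_def)
  have "sqrt (rademacher_sq N x) \<le> sqrt (pi / 2) * D * (\<Sum>n<N. norm (x n) powr p) powr (1 / p)"
    for N and x :: "nat \<Rightarrow> 'a"
  proof (cases "(\<Sum>n<N. norm (x n) powr p) = 0")
    case True
    then have "x n = 0" if "n < N" for n
      using that by (simp add: sum_nonneg_eq_0_iff)
    then show ?thesis using True by (simp add: rademacher_sq_def)
  next
    case False
    define S where "S = (\<Sum>n<N. norm (x n) powr p)"
    have S: "0 < S" using False by (simp add: S_def sum_nonneg order_less_le)
    have N: "0 < N" using False by (cases N) auto
    \<comment> \<open>the summand \<open>S / N\<close> keeps all lengths positive even if some \<open>x n\<close> vanishes\<close>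
    define w where "w n = (norm (x n) powr p + S / N) / (2 * S)" for n
    have w: "0 < w n" for n using S N by (simp add: w_def add_nonneg_pos)
    have "(\<Sum>n<N. w n) = ((\<Sum>n<N. norm (x n) powr p) + (\<Sum>n<N. S / N)) / (2 * S)"
      by (simp only: w_def sum_divide_distrib[symmetric] sum.distrib)
    also have "\<dots> = 1" using S N by (simp add: S_def[symmetric])
    finally have w1: "(\<Sum>n<N. w n) \<le> 1" by simp
    \<comment> \<open>The first summand of \<open>w n\<close> alone gives
      \<open>norm (x n) powr p \<le> 2 * S * w n\<close>.\<close>
    have x: "norm (x n) \<le> (2 * S) powr (1 / p) * w n powr (1 / p)" for n
    proof -
      have "norm (x n) = (norm (x n) powr p) powr (1 / p)" using assms(1) by (simp add: powr_powr)
      also have "\<dots> \<le> (2 * S * w n) powr (1 / p)"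
        using assms(1) S by (intro powr_mono2) (auto simp: w_def)
      finally show ?thesis using S w[of n] by (simp add: powr_mult)
    qed
    obtain e where e: "orthonormal_sys N e"
      "(\<lambda>t. \<Sum>n<N. e n t *\<^sub>R x n) \<in> hoelder_space \<alpha>"
      "hoelder_norm \<alpha> (\<lambda>t. \<Sum>n<N. e n t *\<^sub>R x n) \<le> 4 * sqrt 32 * (2 * S) powr (1 / p)"
      "0 \<le> hoelder_norm \<alpha> (\<lambda>t. \<Sum>n<N. e n t *\<^sub>R x n)"
      using hoelder_tents[OF assms(1,3,4) w w1 x] by auto
    let ?f = "\<lambda>t. \<Sum>n<N. e n t *\<^sub>R x n"
    have "gamma_fun_norm ?f \<le> C * hoelder_norm \<alpha> ?f" by (rule C[OF e(2)])
    also have "\<dots> \<le> \<bar>C\<bar> * (4 * sqrt 32 * (2 * S) powr (1 / p))"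
      using e(3,4) by (intro mult_mono) auto
    also have "\<dots> = D * S powr (1 / p)" using S by (simp add: D_def powr_mult)
    finally have f: "gamma_fun_norm ?f \<le> D * S powr (1 / p)" .
    \<comment> \<open>One function \<open>?f\<close>, independent of the signs, bounds the Gaussian
      sums of all sign patterns at once.\<close>
    have "rademacher_sq N x \<le> pi / 2 * (D * S powr (1 / p))\<^sup>2"
    proof (rule rademacher_sq_le_gauss_sq)
      fix \<epsilon> assume "\<epsilon> \<in> {..<N} \<rightarrow>\<^sub>E {-1, 1::real}"
      from gauss_sq_signs_le_gamma_fun_norm[OF e(1) _ this, of x] e(2) assms(5) f
      have "sqrt (gauss_sq N (\<lambda>n. \<epsilon> n *\<^sub>R x n)) \<le> D * S powr (1 / p)" by fastforce
      then show "gauss_sq N (\<lambda>n. \<epsilon> n *\<^sub>R x n) \<le> (D * S powr (1 / p))\<^sup>2"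
        by (rule sqrt_le_D)
    qed
    then have "sqrt (rademacher_sq N x) \<le> sqrt (pi / 2 * (D * S powr (1 / p))\<^sup>2)" by simp
    also have "\<dots> = sqrt (pi / 2) * D * S powr (1 / p)"
      by (subst real_sqrt_mult) (use D in simp)
    finally show ?thesis by (simp add: S_def)
  qed
  then show ?thesis unfolding has_type_def by blast
qed

end
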